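(* Let $\eta$ be a non-periodic Toeplitz sequence with period structure $(p_n)_{n\ge1}$. Suppose that there are $A_n\subseteq\mathbb N$ ($n\in\mathbb N$) such that $\bigcap_{n\in\mathbb N}\langle A_n\rangle=\{0\}$ and $\widetilde{\mathcal H}_n\subseteq\mathcal M_{A_n}$ for all $n\in\mathbb N$. Let $\tilde\tau_n$ be the minimal period of $\widetilde{\mathcal H}_n$. If $M:=\liminf_{n\to\infty}p_n/\tilde\tau_n<\infty$, then $$\operatorname{Aut}_\sigma(X_\eta)=\langle\sigma\rangle\oplus\operatorname{Tor},$$ where $\operatorname{Tor}$ denotes the torsion group of $\operatorname{Aut}_\sigma(X_\eta)$ (the subgroup of elements of finite order). It is a cyclic group (possibly trivial), whose order divides $M$. In particular, if infinitely many $\widetilde{\mathcal H}_n$ have minimal period $p_n$, then the centralizer of $(X_\eta,\sigma)$ is trivial.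
   Context: $\mathbb N=\{1,2,\dots\}$. For $A\subseteq\mathbb N$, $\langle A\rangle$ is the subgroup of $\mathbb Z$ generated by $A$ and $\mathcal M_A=\bigcup_{a\in A}a\mathbb Z$. A non-periodic Toeplitz sequence with period structure $p_1\mid p_2\mid\dots\to\infty$ is a non-periodic $\eta\in\{0,1\}^{\mathbb Z}$ such that for each $k\in\mathbb Z$ there is $n\ge1$ with $\eta|_{k+p_n\mathbb Z}$ constant. $\sigma$ is the left shift and $X_\eta$ the orbit closure of $\eta$. $\mathcal H_n=\{k\in\mathbb Z:\eta|_{k+p_n\mathbb Z}\text{ is not constant}\}$ (holes at level $n$); essential holes: $\widetilde{\mathcal H}_N=\{k\in\mathcal H_N:\mathcal H_n\cap(k+p_N\mathbb Z)\neq\emptyset\ \forall n\ge N\}$, a $p_N$-periodic set, so that $\tilde\tau_N\mid p_N$. Standing assumption: the odometer $G=\varprojlim\mathbb Z/p_n\mathbb Z$ with translation by $(1,1,\dots)$ is the maximal equicontinuous factor of $(X_\eta,\sigma)$. $\operatorname{Aut}_\sigma(X_\eta)$ (the automorphism group, or centralizer) is the group of homeomorphisms of $X_\eta$ commuting with $\sigma$; it is called trivial if it consists only of powers of $\sigma$. *)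

theory Defs
  imports
    "HOL-Analysis.Analysis"
    "HOL-Algebra.Elementary_Groups"
    "HOL-Algebra.Bij"
begin

text \<open>
  Points of \<open>{0,1}\<^sup>\<int>\<close> are functions \<open>int \<Rightarrow> bool\<close> (\<open>False\<close> is 0, \<open>True\<close> is 1); the type class
  topology on this type is the product of the discrete topologies.
  Sequences indexed by \<open>{1,2,\<dots>}\<close> are functions on \<open>nat\<close> whose value at 0 is never used.
\<close>

section \<open>Toeplitz sequences and their holes\<close>

definition progression :: "int \<Rightarrow> nat \<Rightarrow> int set" where
  "progression k m = range (\<lambda>j::int. k + int m * j)"

definition periodic_seq :: "(int \<Rightarrow> bool) \<Rightarrow> bool" where
  "periodic_seq \<eta> \<longleftrightarrow> (\<exists>t::nat. t \<ge> 1 \<and> (\<forall>k. \<eta> (k + int t) = \<eta> k))"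

definition nonperiodic_toeplitz :: "(int \<Rightarrow> bool) \<Rightarrow> (nat \<Rightarrow> nat) \<Rightarrow> bool" where
  "nonperiodic_toeplitz \<eta> p \<longleftrightarrow>
     (\<forall>n\<ge>1. p n \<ge> 1) \<and> (\<forall>n\<ge>1. p n dvd p (Suc n)) \<and> filterlim p at_top sequentially \<and>
     \<not> periodic_seq \<eta> \<and>
     (\<forall>k. \<exists>n\<ge>1. \<eta> constant_on progression k (p n))"

definition holes :: "(int \<Rightarrow> bool) \<Rightarrow> (nat \<Rightarrow> nat) \<Rightarrow> nat \<Rightarrow> int set" where
  "holes \<eta> p n = {k. \<not> \<eta> constant_on progression k (p n)}"

definition essential_holes :: "(int \<Rightarrow> bool) \<Rightarrow> (nat \<Rightarrow> nat) \<Rightarrow> nat \<Rightarrow> int set" where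
  "essential_holes \<eta> p N =
     {k \<in> holes \<eta> p N. \<forall>n\<ge>N. holes \<eta> p n \<inter> progression k (p N) \<noteq> {}}"

definition min_period :: "int set \<Rightarrow> nat" where
  "min_period S = (LEAST t. t \<ge> 1 \<and> (\<forall>k. k + int t \<in> S \<longleftrightarrow> k \<in> S))"

definition multiples :: "nat set \<Rightarrow> int set" where
  "multiples A = (\<Union>a\<in>A. range (\<lambda>j::int. int a * j))"

section \<open>The subshift generated by a sequence and its automorphism group\<close>

definition shift :: "(int \<Rightarrow> bool) \<Rightarrow> (int \<Rightarrow> bool)" where
  "shift x = (\<lambda>k. x (k + 1))"

definition orbit_closure :: "(int \<Rightarrow> bool) \<Rightarrow> (int \<Rightarrow> bool) set" where
  "orbit_closure \<eta> = closure (range (\<lambda>n::int. \<lambda>k. \<eta> (k + n)))"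

text \<open>
  As in \<^const>\<open>BijGroup\<close>, self-maps of \<open>topspace X\<close> are taken extensional, so that distinct group
  elements are distinct as maps on the space; the operation is composition.
\<close>

definition Aut :: "'a topology \<Rightarrow> ('a \<Rightarrow> 'a) \<Rightarrow> ('a \<Rightarrow> 'a) monoid" where
  "Aut X T = BijGroup (topspace X)
     \<lparr>carrier := {f \<in> Bij (topspace X). homeomorphic_map X X f \<and>
                   (\<forall>x\<in>topspace X. f (T x) = T (f x))}\<rparr>"

definition torsion :: "('a, 'b) monoid_scheme \<Rightarrow> 'a set" where
  "torsion G = {f \<in> carrier G. \<exists>n::nat. n \<ge> 1 \<and> f [^]\<^bsub>G\<^esub> n = \<one>\<^bsub>G\<^esub>}"

definition internal_direct_sum ::
    "('a, 'b) monoid_scheme \<Rightarrow> 'a set \<Rightarrow> 'a set \<Rightarrow> bool" where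
  "internal_direct_sum G H K \<longleftrightarrow>
     subgroup H G \<and> subgroup K G \<and>
     (\<lambda>(x, y). x \<otimes>\<^bsub>G\<^esub> y) \<in> iso (G\<lparr>carrier := H\<rparr> \<times>\<times> G\<lparr>carrier := K\<rparr>) G"

section \<open>Maximal equicontinuous factors and odometers\<close>

definition factor_map ::
    "'a topology \<Rightarrow> ('a \<Rightarrow> 'a) \<Rightarrow> 'b topology \<Rightarrow> ('b \<Rightarrow> 'b) \<Rightarrow> ('a \<Rightarrow> 'b) \<Rightarrow> bool" where
  "factor_map X T Y S \<pi> \<longleftrightarrow>
     continuous_map X Y \<pi> \<and> \<pi> ` topspace X = topspace Y \<and>
     (\<forall>x\<in>topspace X. \<pi> (T x) = S (\<pi> x))"

text \<open>
  Equicontinuity of the family of all integer powers of a homeomorphism of a compact metrizable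
  space. By compactness it does not depend on the choice of the compatible metric.
\<close>

definition equicontinuous_system :: "'a topology \<Rightarrow> ('a \<Rightarrow> 'a) \<Rightarrow> bool" where
  "equicontinuous_system Y S \<longleftrightarrow>
     compact_space Y \<and> homeomorphic_map Y Y S \<and>
     (\<exists>d. Metric_space (topspace Y) d \<and> Metric_space.mtopology (topspace Y) d = Y \<and>
        (\<forall>\<epsilon>>0. \<exists>\<delta>>0. \<forall>x\<in>topspace Y. \<forall>y\<in>topspace Y. d x y < \<delta> \<longrightarrow>
           (\<forall>n::nat. d ((S ^^ n) x) ((S ^^ n) y) < \<epsilon> \<and>
              d ((inv_into (topspace Y) S ^^ n) x) ((inv_into (topspace Y) S ^^ n) y) < \<epsilon>)))"

text \<open>
  \<open>(Y, S)\<close> is the maximal equicontinuous factor of \<open>(X, T)\<close>: it is an equicontinuous factor through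
  which every equicontinuous factor of \<open>(X, T)\<close> factors. The other factors range over spaces whose
  points are sets of points of \<open>X\<close>. For \<open>X\<close> compact metrizable (the only use below) this is no
  restriction: a factor \<open>\<rho>\<close> of \<open>X\<close> is isomorphic to the quotient of \<open>X\<close> by the fibres of \<open>\<rho>\<close>, and all
  its compact Hausdorff factors are metrizable.
\<close>

definition is_max_equicontinuous_factor ::
    "'a topology \<Rightarrow> ('a \<Rightarrow> 'a) \<Rightarrow> 'b topology \<Rightarrow> ('b \<Rightarrow> 'b) \<Rightarrow> bool" where
  "is_max_equicontinuous_factor X T Y S \<longleftrightarrow>
     equicontinuous_system Y S \<and>
     (\<exists>\<pi>. factor_map X T Y S \<pi> \<and>
        (\<forall>(Z :: 'a set topology) R \<rho>.
           equicontinuous_system Z R \<and> factor_map X T Z R \<rho> \<longrightarrow>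
           (\<exists>h. factor_map Y S Z R h \<and> (\<forall>x\<in>topspace X. \<rho> x = h (\<pi> x)))))"

text \<open>
  The inverse limit of \<open>\<int>/p\<^sub>n\<int>\<close>, \<open>n \<ge> 1\<close>, with residue classes represented by \<open>{0..<p\<^sub>n}\<close>, inside the
  product of the discrete spaces, and its translation by \<open>(1,1,\<dots>)\<close>.
\<close>

definition odometer :: "(nat \<Rightarrow> nat) \<Rightarrow> (nat \<Rightarrow> int) topology" where
  "odometer p =
     subtopology (product_topology (\<lambda>n. discrete_topology {0..<int (p n)}) {1..})
       {g. \<forall>n\<ge>1. g (Suc n) mod int (p n) = g n}"

definition odometer_translation :: "(nat \<Rightarrow> nat) \<Rightarrow> (nat \<Rightarrow> int) \<Rightarrow> (nat \<Rightarrow> int)" where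
  "odometer_translation p g = (\<lambda>n\<in>{1..}. (g n + 1) mod int (p n))"

end

theory Submission
  imports Defs "HOL-Number_Theory.Cong" "HOL-Algebra.Multiplicative_Group"
begin

text \<open>
  The difference of the odometer coordinate of \<open>F x\<close> and that of \<open>x\<close> does not depend on \<open>x\<close>, so
  every automorphism \<open>F\<close> induces a translation of the odometer, and \<open>F\<close> is determined by it because
  the fibre through \<open>\<eta>\<close> is a single point. A residue \<open>k\<close> is a hole at level \<open>n\<close> iff two points over
  \<open>k\<close> differ at coordinate 0. The inverse of \<open>F\<close> is a block code of some radius \<open>r\<close>, so at every level
  \<open>n\<close> the translation moves each essential hole to within distance \<open>r\<close> of an essential hole. The
  groups generated by the essential holes decrease to 0. Hence, for large \<open>n\<close>, the correction
  \<open>\<bar>i\<bar> \<le> r\<close> is unique and depends neither on the hole nor on \<open>n\<close>. After composing \<open>F\<close> with \<open>\<sigma>\<^sup>i\<close>,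
  the translation preserves the essential holes, so its level \<open>n\<close> coordinate is a multiple of \<open>\<tau> n\<close>.
  If \<open>p n = m * \<tau> n\<close> for infinitely many \<open>n\<close>, then the \<open>m\<close>-th power of the composition is trivial.
\<close>

section \<open>Groups of odometer translations\<close>

text \<open>Division with remainder by the least positive element; \<open>d = 0\<close> covers the
  trivial subgroup.\<close>

lemma subgroup_integer_group_eq_multiples:
  assumes "subgroup H integer_group"
  obtains d where "H = {k. d dvd k}"
proof -
  have zero: "0 \<in> H"
    using subgroup.one_closed[OF assms] by simp
  have add: "a + b \<in> H" if "a \<in> H" "b \<in> H" for a b
    using subgroup.m_closed[OF assms that] by simp
  have uminus: "- a \<in> H" if "a \<in> H" for a
    using subgroup.m_inv_closed[OF assms that] by simp
  have mult: "c * a \<in> H" if "a \<in> H" for a c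
    using group.subgroup_int_pow_closed[OF group_integer_group assms that, of c] by simp
  show thesis
  proof (cases "H = {0}")
    case True
    then show thesis using that[of 0] by auto
  next
    case False
    then obtain a where a: "a \<in> H" "a \<noteq> 0"
      using zero by blast
    define P where "P = (\<lambda>n::nat. n \<ge> 1 \<and> int n \<in> H)"
    have "P (nat \<bar>a\<bar>)"
      using a uminus by (auto simp: P_def abs_if)
    then have least: "P (LEAST n. P n)"
      by (rule LeastI)
    have min: "(LEAST n. P n) \<le> n" if "P n" for n
      using that by (rule Least_le)
    define d where "d = int (LEAST n. P n)"
    have d: "d \<in> H" "d \<ge> 1"
      using least by (auto simp: P_def d_def)
    have "d dvd k" if "k \<in> H" for k
    proof -
      have "k mod d = k + (- (k div d)) * d"
        by (simp add: minus_div_mult_eq_mod[symmetric])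
      then have "k mod d \<in> H"
        using add mult that d(1) by metis
      moreover have "0 \<le> k mod d" "k mod d < d"
        using d(2) by auto
      moreover have "\<not> P (nat (k mod d))"
        using min[of "nat (k mod d)"] \<open>k mod d < d\<close> d(2) unfolding d_def by linarith
      ultimately have "k mod d = 0"
        by (simp add: P_def)
      then show ?thesis by auto
    qed
    moreover have "k \<in> H" if "d dvd k" for k
      using mult[OF d(1), of "k div d"] that by simp
    ultimately show thesis
      by (intro that[of d]) blast
  qed
qed

lemma dvd_chain:
  fixes p :: "nat \<Rightarrow> nat"
  assumes "\<And>n. n \<ge> 1 \<Longrightarrow> p n dvd p (Suc n)" "1 \<le> n" "n \<le> n'"
  shows "p n dvd p n'"
  using assms(3)
proof (induction n' rule: dec_induct)
  case (step k)
  then show ?case using assms(1)[of k] assms(2) dvd_trans by auto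
qed simp

text \<open>A homomorphism into Z/q written through integer representatives: \<open>h\<close> is
  additive only up to multiples of \<open>q\<close>, so no quotient group has to be formed.\<close>

locale cong_hom = group G for G (structure) +
  fixes h :: "'a \<Rightarrow> int" and q :: int
  assumes mult: "\<And>x y. x \<in> carrier G \<Longrightarrow> y \<in> carrier G \<Longrightarrow> [h (x \<otimes> y) = h x + h y] (mod q)"
begin

lemma one: "[h \<one> = 0] (mod q)"
  using mult[of \<one> \<one>] by (simp add: cong_iff_dvd_diff dvd_diff_commute)

lemma inv: "[h (inv x) = - h x] (mod q)" if "x \<in> carrier G"
  using cong_trans[OF cong_sym[OF mult[OF inv_closed[OF that] that]], of 0] one that
  by (simp add: cong_iff_dvd_diff)

lemma nat_pow: "[h (x [^] n) = int n * h x] (mod q)" if "x \<in> carrier G" for n :: nat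
proof (induction n)
  case (Suc n)
  have "[h (x [^] n \<otimes> x) = int n * h x + h x] (mod q)"
    using cong_trans[OF mult cong_add[OF Suc cong_refl]] that by auto
  then show ?case by (simp add: algebra_simps)
qed (use one in simp)

lemma int_pow: "[h (x [^] k) = k * h x] (mod q)" if "x \<in> carrier G" for k :: int
proof (cases k rule: int_cases2)
  case (nonneg n)
  then show ?thesis using nat_pow[OF that, of n] by (simp add: int_pow_int)
next
  case (nonpos n)
  then have eq: "x [^] k = inv (x [^] n)"
    using that by (simp add: int_pow_neg int_pow_int)
  have "[h (inv (x [^] n)) = - (int n * h x)] (mod q)"
    using cong_trans[OF inv cong_minus_minus_iff[THEN iffD2, OF nat_pow]] that by auto
  with nonpos eq show ?thesis by simp
qed

text \<open>\<open>J\<close> is the preimage in Z of the image of \<open>h\<close> in Z/q, hence of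
  the form dZ. An \<open>x\<close> with \<open>h x\<close> congruent to \<open>d\<close> generates:
  if \<open>h y = k * d\<close>, then \<open>y\<close> and \<open>x [^] k\<close> have the same
  image, and the kernel is trivial.\<close>

lemma cyclic_group_if_inj:
  assumes inj: "\<And>x. x \<in> carrier G \<Longrightarrow> [h x = 0] (mod q) \<Longrightarrow> x = \<one>"
  shows "cyclic_group G"
proof -
  define J where "J = {j. \<exists>x\<in>carrier G. [h x = j] (mod q)}"
  have "subgroup J integer_group"
  proof
    fix i j assume "i \<in> J" "j \<in> J"
    then obtain x y where "x \<in> carrier G" "[h x = i] (mod q)" "y \<in> carrier G" "[h y = j] (mod q)"
      by (auto simp: J_def)
    then show "i \<otimes>\<^bsub>integer_group\<^esub> j \<in> J"
      using cong_trans[OF mult cong_add, of x y i j] by (auto simp: J_def)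
  next
    fix i assume "i \<in> J"
    then obtain x where "x \<in> carrier G" "[h x = i] (mod q)"
      by (auto simp: J_def)
    then show "inv\<^bsub>integer_group\<^esub> i \<in> J"
      using cong_trans[OF inv cong_minus_minus_iff[THEN iffD2], of x i] by (auto simp: J_def)
  qed (use one in \<open>auto simp: J_def\<close>)
  then obtain d where d: "J = {k. d dvd k}"
    by (rule subgroup_integer_group_eq_multiples)
  then have "d \<in> J" by simp
  then obtain x where x: "x \<in> carrier G" "[h x = d] (mod q)"
    by (auto simp: J_def)
  have "y \<in> range (\<lambda>k::int. x [^] k)" if y: "y \<in> carrier G" for y
  proof -
    have "h y \<in> J"
      unfolding J_def using y by (blast intro: cong_refl)
    then obtain k where k: "h y = k * d"
      unfolding d by (metis dvdE mem_Collect_eq mult.commute)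
    have xk: "[h (x [^] k) = k * d] (mod q)"
      using cong_trans[OF int_pow[OF x(1)] cong_scalar_left[OF x(2)]] .
    have "[h (y \<otimes> inv (x [^] k)) = h y + - h (x [^] k)] (mod q)"
      using cong_trans[OF mult cong_add[OF cong_refl inv]] x y by auto
    also have "[h y + - h (x [^] k) = k * d + - (k * d)] (mod q)"
      unfolding k by (intro cong_add cong_refl cong_minus_minus_iff[THEN iffD2] xk)
    finally have "y \<otimes> inv (x [^] k) = \<one>"
      using inj x y by simp
    then have "y = x [^] k"
      using x y by (metis int_pow_closed inv_closed inv_equality inv_inv)
    then show ?thesis by blast
  qed
  then show ?thesis
    unfolding cyclic_group using x by (intro bexI[of _ x]) auto
qed

end

text \<open>The \<open>f n\<close> are compatible homomorphisms to Z/p_n with trivial joint kernel,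
  so \<open>G\<close> embeds in the odometer, with \<open>\<sigma>\<close> sent to (1,1,...). This
  separates the group theory from the dynamics.\<close>

locale odometer_rotation = group G for G (structure) +
  fixes p :: "nat \<Rightarrow> nat" and f :: "nat \<Rightarrow> 'a \<Rightarrow> int" and \<sigma> :: 'a
  assumes p_Suc: "\<And>n. n \<ge> 1 \<Longrightarrow> p n dvd p (Suc n)"
    and p_lim: "filterlim p at_top sequentially"
    and f_mult: "\<And>n x y. n \<ge> 1 \<Longrightarrow> x \<in> carrier G \<Longrightarrow> y \<in> carrier G \<Longrightarrow>
      [f n (x \<otimes> y) = f n x + f n y] (mod int (p n))"
    and f_Suc: "\<And>n x. n \<ge> 1 \<Longrightarrow> x \<in> carrier G \<Longrightarrow> [f (Suc n) x = f n x] (mod int (p n))"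
    and f_inj: "\<And>x. x \<in> carrier G \<Longrightarrow> (\<And>n. n \<ge> 1 \<Longrightarrow> [f n x = 0] (mod int (p n))) \<Longrightarrow> x = \<one>"
    and \<sigma>: "\<sigma> \<in> carrier G"
    and f_\<sigma>: "\<And>n. n \<ge> 1 \<Longrightarrow> [f n \<sigma> = 1] (mod int (p n))"
begin

lemma cong_hom: "n \<ge> 1 \<Longrightarrow> cong_hom G (f n) (int (p n))"
  by unfold_locales (rule f_mult)

lemma p_dvd: "1 \<le> n \<Longrightarrow> n \<le> n' \<Longrightarrow> p n dvd p n'"
  by (rule dvd_chain[of p, OF p_Suc])

lemma f_cong:
  assumes "1 \<le> n" "n \<le> n'" "x \<in> carrier G"
  shows "[f n' x = f n x] (mod int (p n))"
  using assms(2)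
proof (induction n' rule: dec_induct)
  case (step k)
  then have "[f (Suc k) x = f k x] (mod int (p n))"
    using assms by (intro cong_dvd_modulus[OF f_Suc[of k x]]) (auto intro: p_dvd)
  then show ?case using step by (auto intro: cong_trans)
qed simp

text \<open>A coordinate at a high level determines all lower ones, so vanishing on any infinite set
  of levels is enough.\<close>

lemma eq_oneI:
  assumes "x \<in> carrier G" "infinite I" "\<And>n. n \<in> I \<Longrightarrow> n \<ge> 1 \<Longrightarrow> [f n x = 0] (mod int (p n))"
  shows "x = \<one>"
proof (rule f_inj)
  fix n :: nat assume n: "n \<ge> 1"
  obtain n' where n': "n' \<in> I" "n' \<ge> n"
    using assms(2) unfolding infinite_nat_iff_unbounded_le by blast
  have "[f n' x = 0] (mod int (p n))"
    using n n' by (intro cong_dvd_modulus[OF assms(3)]) (auto intro: p_dvd)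
  then show "[f n x = 0] (mod int (p n))"
    using f_cong[OF n n'(2) assms(1)] cong_sym cong_trans by blast
qed fact

text \<open>The coordinates take values in abelian groups, so the quotient of
  \<open>x \<otimes> y\<close> by \<open>y \<otimes> x\<close> vanishes at every level.\<close>

lemma comm_group: "comm_group G"
proof (rule group_comm_groupI)
  fix x y assume xy: "x \<in> carrier G" "y \<in> carrier G"
  have "x \<otimes> y \<otimes> inv (y \<otimes> x) = \<one>"
  proof (rule f_inj)
    fix n :: nat assume n: "n \<ge> 1"
    interpret h: cong_hom G "f n" "int (p n)"
      by (rule cong_hom[OF n])
    have "[f n (x \<otimes> y \<otimes> inv (y \<otimes> x)) = f n (x \<otimes> y) + f n (inv (y \<otimes> x))] (mod int (p n))"
      using xy by (intro h.mult) auto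
    also have "[f n (x \<otimes> y) + f n (inv (y \<otimes> x)) = (f n x + f n y) + - (f n y + f n x)] (mod int (p n))"
      using xy by (intro cong_add h.mult cong_trans[OF h.inv] cong_minus_minus_iff[THEN iffD2]) auto
    finally show "[f n (x \<otimes> y \<otimes> inv (y \<otimes> x)) = 0] (mod int (p n))"
      by simp
  qed (use xy in auto)
  then show "x \<otimes> y = y \<otimes> x"
    using xy by (metis inv_closed inv_equality inv_inv m_closed)
qed

text \<open>The moduli are unbounded: at a level where \<open>p n\<close> exceeds the absolute value
  of \<open>i * m\<close>, the coordinate \<open>m * i\<close> is divisible by \<open>p n\<close>
  only if it is 0.\<close>

lemma int_pow_\<sigma>_torsion:
  assumes "(\<sigma> [^] (i::int)) [^] (m::nat) = \<one>" "m \<ge> 1"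
  shows "i = 0"
proof -
  have "eventually (\<lambda>n. p n \<ge> Suc (nat (\<bar>i\<bar> * int m))) sequentially"
    using p_lim unfolding filterlim_at_top by blast
  then obtain n where n: "n \<ge> 1" "p n > nat (\<bar>i\<bar> * int m)"
    using eventually_happens'[OF sequentially_bot eventually_conj[OF _ eventually_ge_at_top[of 1]]]
    by (metis Suc_le_eq)
  interpret h: cong_hom G "f n" "int (p n)"
    by (rule cong_hom[OF n(1)])
  have "[f n ((\<sigma> [^] i) [^] m) = int m * f n (\<sigma> [^] i)] (mod int (p n))"
    using \<sigma> by (intro h.nat_pow) auto
  also have "[int m * f n (\<sigma> [^] i) = int m * (i * f n \<sigma>)] (mod int (p n))"
    using \<sigma> by (intro cong_scalar_left h.int_pow)
  also have "[int m * (i * f n \<sigma>) = int m * (i * 1)] (mod int (p n))"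
    using n by (intro cong_scalar_left f_\<sigma>)
  finally have "[int m * i = 0] (mod int (p n))"
    unfolding assms(1) using h.one by (metis cong_sym cong_trans mult.right_neutral)
  then have "int (p n) dvd int m * i"
    by (simp add: cong_0_iff)
  moreover have "\<bar>int m * i\<bar> < int (p n)"
    using n(2) by (simp add: abs_mult mult.commute)
  ultimately have "int m * i = 0"
    using dvd_imp_le_int[of "int m * i" "int (p n)"] by linarith
  then show ?thesis using assms(2) by simp
qed


section \<open>Torsion elements and their bound\<close>

lemma mult_int_pow: "(x \<otimes> y) [^] (m::nat) = x [^] m \<otimes> y [^] m"
  if "x \<in> carrier G" "y \<in> carrier G"
  using comm_monoid.nat_pow_distrib[OF comm_group.axioms(1)[OF comm_group]] that by blast

lemma torsion_subgroup: "subgroup (torsion G) G"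
proof
  show "torsion G \<subseteq> carrier G" "\<one> \<in> torsion G"
    by (auto simp: torsion_def)
next
  fix x y assume "x \<in> torsion G" "y \<in> torsion G"
  then obtain m n :: nat where x: "x \<in> carrier G" "m \<ge> 1" "x [^] m = \<one>"
    and y: "y \<in> carrier G" "n \<ge> 1" "y [^] n = \<one>"
    by (auto simp: torsion_def)
  have "(x \<otimes> y) [^] (m * n) = (x [^] m) [^] n \<otimes> (y [^] n) [^] m"
    using x(1) y(1) by (simp add: mult_int_pow nat_pow_pow mult.commute)
  also have "\<dots> = \<one>"
    using x y by simp
  finally show "x \<otimes> y \<in> torsion G"
    using x y by (auto simp: torsion_def intro!: exI[of _ "m * n"])
next
  fix x assume "x \<in> torsion G"
  then show "inv x \<in> torsion G"
    by (auto simp: torsion_def nat_pow_inv)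
qed

lemma int_pow_\<sigma>_torsionD: "\<sigma> [^] (i::int) \<in> torsion G \<Longrightarrow> i = 0"
  using int_pow_\<sigma>_torsion by (auto simp: torsion_def)

lemma eqI:
  assumes "x \<in> carrier G" "y \<in> carrier G" "infinite I"
    "\<And>n. n \<in> I \<Longrightarrow> n \<ge> 1 \<Longrightarrow> [f n x = f n y] (mod int (p n))"
  shows "x = y"
proof -
  have "x \<otimes> inv y = \<one>"
  proof (rule eq_oneI[OF _ assms(3)])
    fix n assume n: "n \<in> I" "n \<ge> 1"
    interpret h: cong_hom G "f n" "int (p n)"
      by (rule cong_hom[OF n(2)])
    have "[f n (x \<otimes> inv y) = f n x + f n (inv y)] (mod int (p n))"
      using assms by (intro h.mult) auto
    also have "[f n x + f n (inv y) = f n y + - f n y] (mod int (p n))"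
      using assms n by (intro cong_add h.inv assms(4))
    finally show "[f n (x \<otimes> inv y) = 0] (mod int (p n))"
      by simp
  qed (use assms in auto)
  then show ?thesis
    using assms by (metis inv_closed inv_equality inv_inv)
qed

text \<open>
  An element that after multiplication with a power of \<open>\<sigma>\<close> rotates by a multiple of \<open>\<tau> n\<close> at all
  large levels \<open>n\<close> becomes torsion, because \<open>m * \<tau> n = p n\<close> for infinitely many \<open>n\<close>.
\<close>

context
  fixes \<tau> :: "nat \<Rightarrow> nat" and m :: nat
  assumes m: "m \<ge> 1"
    and inf: "infinite {n. n \<ge> 1 \<and> p n = m * \<tau> n}"
    and p_pos: "\<And>n. n \<ge> 1 \<Longrightarrow> p n \<ge> 1"
    and ex_dvd: "\<And>x. x \<in> carrier G \<Longrightarrow> \<exists>i N. \<forall>n\<ge>N. int (\<tau> n) dvd f n x + i"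
begin

lemma infinite_large: "infinite {n. n \<ge> 1 \<and> p n = m * \<tau> n \<and> n \<ge> N}"
proof -
  have "{n. n \<ge> 1 \<and> p n = m * \<tau> n} \<subseteq> {n. n \<ge> 1 \<and> p n = m * \<tau> n \<and> n \<ge> N} \<union> {..<N}"
    by auto
  then show ?thesis using inf finite_subset by blast
qed

lemma f_\<sigma>_pow_mult:
  assumes "x \<in> carrier G" "n \<ge> 1"
  shows "[f n (\<sigma> [^] (i::int) \<otimes> x) = f n x + i] (mod int (p n))"
proof -
  interpret h: cong_hom G "f n" "int (p n)"
    by (rule cong_hom[OF assms(2)])
  have "[f n (\<sigma> [^] i \<otimes> x) = f n (\<sigma> [^] i) + f n x] (mod int (p n))"
    using \<sigma> assms by (intro h.mult) auto
  also have "[f n (\<sigma> [^] i) + f n x = i * 1 + f n x] (mod int (p n))"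
    using \<sigma> assms by (intro cong_add cong_refl cong_trans[OF h.int_pow] cong_scalar_left f_\<sigma>)
  finally show ?thesis by (simp add: add.commute)
qed

text \<open>The coordinate of the \<open>m\<close>-th power is \<open>m\<close> times a multiple of
  \<open>\<tau> n\<close>, hence a multiple of \<open>m * \<tau> n = p n\<close>, at infinitely many
  levels.\<close>

lemma pow_eq_one:
  assumes "x \<in> carrier G"
    "\<And>n. n \<ge> N \<Longrightarrow> n \<ge> 1 \<Longrightarrow> p n = m * \<tau> n \<Longrightarrow> int (\<tau> n) dvd f n x"
  shows "x [^] m = \<one>"
proof (rule eq_oneI[OF _ infinite_large[of N]])
  fix n assume n: "n \<in> {n. n \<ge> 1 \<and> p n = m * \<tau> n \<and> n \<ge> N}" "n \<ge> 1"
  interpret h: cong_hom G "f n" "int (p n)"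
    by (rule cong_hom[OF n(2)])
  have "int (p n) dvd int m * f n x"
    using n assms(2)[of n] by (auto intro: mult_dvd_mono)
  then show "[f n (x [^] m) = 0] (mod int (p n))"
    using h.nat_pow[OF assms(1), of m] cong_trans by (simp add: cong_0_iff cong_dvd_iff)
qed (use assms in auto)

text \<open>A factor \<open>\<sigma> [^] i\<close> adds \<open>i\<close> to each coordinate, which
  turns \<open>ex_dvd\<close> into divisibility by \<open>\<tau> n\<close> at large levels with
  \<open>p n = m * \<tau> n\<close>; then \<open>pow_eq_one\<close> applies.\<close>

lemma decompose:
  assumes "x \<in> carrier G"
  obtains i :: int and N where "\<sigma> [^] i \<otimes> x \<in> torsion G"
    "\<And>n. n \<ge> N \<Longrightarrow> n \<ge> 1 \<Longrightarrow> p n = m * \<tau> n \<Longrightarrow> int (\<tau> n) dvd f n (\<sigma> [^] i \<otimes> x)"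
    "(\<sigma> [^] i \<otimes> x) [^] m = \<one>"
proof -
  obtain i N where N: "\<And>n. n \<ge> N \<Longrightarrow> int (\<tau> n) dvd f n x + i"
    using ex_dvd[OF assms] by blast
  have dvd: "int (\<tau> n) dvd f n (\<sigma> [^] i \<otimes> x)" if "n \<ge> N" "n \<ge> 1" "p n = m * \<tau> n" for n
  proof -
    have "[f n (\<sigma> [^] i \<otimes> x) = f n x + i] (mod int (\<tau> n))"
      using cong_dvd_modulus[OF f_\<sigma>_pow_mult[OF assms that(2)], of "int (\<tau> n)" i] that(3) by simp
    then show ?thesis
      using N[OF that(1)] cong_dvd_iff by blast
  qed
  have "(\<sigma> [^] i \<otimes> x) [^] m = \<one>"
    using \<sigma> assms dvd by (intro pow_eq_one[of _ N]) auto
  then show thesis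
    using that[of i N] dvd m assms \<sigma> by (auto simp: torsion_def)
qed

text \<open>In the decomposition of a torsion element the power of \<open>\<sigma>\<close> is a
  quotient of two torsion elements. So its exponent is 0, and \<open>x\<close> itself has the
  properties given by \<open>decompose\<close>.\<close>

lemma torsionD:
  assumes "x \<in> torsion G"
  shows "x [^] m = \<one>"
    and "\<exists>N. \<forall>n\<ge>N. n \<ge> 1 \<longrightarrow> p n = m * \<tau> n \<longrightarrow> int (\<tau> n) dvd f n x"
proof -
  interpret T: subgroup "torsion G" G
    by (rule torsion_subgroup)
  obtain i :: int and N where i: "\<sigma> [^] i \<otimes> x \<in> torsion G"
    "\<And>n. n \<ge> N \<Longrightarrow> n \<ge> 1 \<Longrightarrow> p n = m * \<tau> n \<Longrightarrow> int (\<tau> n) dvd f n (\<sigma> [^] i \<otimes> x)"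
    "(\<sigma> [^] i \<otimes> x) [^] m = \<one>"
    using decompose[OF T.mem_carrier[OF assms]] by metis
  have "\<sigma> [^] i = (\<sigma> [^] i \<otimes> x) \<otimes> inv x"
    using \<sigma> assms by (simp add: m_assoc)
  then have "\<sigma> [^] i \<in> torsion G"
    using T.m_closed[OF i(1) T.m_inv_closed[OF assms]] by simp
  then have "i = 0"
    by (rule int_pow_\<sigma>_torsionD)
  then have "\<sigma> [^] i \<otimes> x = x"
    using assms by simp
  then show "x [^] m = \<one>"
    and "\<exists>N. \<forall>n\<ge>N. n \<ge> 1 \<longrightarrow> p n = m * \<tau> n \<longrightarrow> int (\<tau> n) dvd f n x"
    using i by auto
qed

text \<open>A single level that sees all of \<open>S\<close>: its coordinate embeds \<open>S\<close>
  in the subgroup of Z/p_n generated by \<open>\<tau> n\<close>, which has order \<open>m\<close>.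
  Distinct elements differ at some level and then at all higher ones, so only finitely many
  thresholds have to be passed.\<close>

lemma ex_level:
  assumes "finite S" "S \<subseteq> torsion G"
  obtains n where "n \<ge> 1" "p n = m * \<tau> n" "\<And>x. x \<in> S \<Longrightarrow> int (\<tau> n) dvd f n x"
    "\<And>x y. x \<in> S \<Longrightarrow> y \<in> S \<Longrightarrow> [f n x = f n y] (mod int (p n)) \<Longrightarrow> x = y"
proof -
  define I where "I = {n. n \<ge> 1 \<and> p n = m * \<tau> n}"
  have "\<forall>x\<in>S. \<exists>N. \<forall>n\<ge>N. n \<in> I \<longrightarrow> int (\<tau> n) dvd f n x"
    using torsionD(2) assms(2) unfolding I_def by blast
  then obtain N where N: "\<And>x n. x \<in> S \<Longrightarrow> n \<ge> N x \<Longrightarrow> n \<in> I \<Longrightarrow> int (\<tau> n) dvd f n x"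
    by metis
  have "\<exists>K\<ge>1. \<not> [f K x = f K y] (mod int (p K))" if "x \<in> S" "y \<in> S" "x \<noteq> y" for x y
    using eqI[of x y UNIV] that assms(2) by (auto simp: torsion_def)
  then obtain K where K: "\<And>x y. x \<in> S \<Longrightarrow> y \<in> S \<Longrightarrow> x \<noteq> y \<Longrightarrow>
      K x y \<ge> 1 \<and> \<not> [f (K x y) x = f (K x y) y] (mod int (p (K x y)))"
    by metis
  \<comment> \<open>On the diagonal \<open>K\<close> is arbitrary, which can only raise the
    bound.\<close>
  define B where "B = N ` S \<union> (\<lambda>(x, y). K x y) ` (S \<times> S)"
  have "finite B"
    using assms(1) by (simp add: B_def)
  then obtain b where b: "\<And>k. k \<in> B \<Longrightarrow> k \<le> b"
    unfolding finite_nat_set_iff_bounded_le by blast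
  obtain n where n: "n \<in> I" "n \<ge> b"
    using inf unfolding infinite_nat_iff_unbounded_le I_def by blast
  show thesis
  proof (rule that[of n])
    show "n \<ge> 1" "p n = m * \<tau> n"
      using n by (auto simp: I_def)
    show "int (\<tau> n) dvd f n x" if "x \<in> S" for x
      using N[OF that] b[of "N x"] n that by (auto simp: B_def)
    show "x = y" if xy: "x \<in> S" "y \<in> S" "[f n x = f n y] (mod int (p n))" for x y
    proof (rule ccontr)
      assume "x \<noteq> y"
      then have k: "K x y \<ge> 1" "\<not> [f (K x y) x = f (K x y) y] (mod int (p (K x y)))"
        using K xy by auto
      have le: "K x y \<le> n"
        using b[of "K x y"] xy n(2) by (force simp: B_def)
      have S: "x \<in> carrier G" "y \<in> carrier G"
        using xy assms(2) by (auto simp: torsion_def)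
      have "[f n x = f n y] (mod int (p (K x y)))"
        using p_dvd[OF k(1) le] by (intro cong_dvd_modulus[OF xy(3)]) simp
      then have "[f (K x y) x = f (K x y) y] (mod int (p (K x y)))"
        using f_cong[OF k(1) le S(1)] f_cong[OF k(1) le S(2)] by (metis cong_sym cong_trans)
      then show False using k by blast
    qed
  qed
qed

text \<open>At a suitable level, \<open>m + 1\<close> torsion elements would be distinct multiples
  of \<open>\<tau> n\<close> modulo \<open>m * \<tau> n\<close>, of which there are only
  \<open>m\<close>.\<close>

lemma finite_torsion: "finite (torsion G)"
proof (rule ccontr)
  assume "infinite (torsion G)"
  then obtain S where S: "finite S" "card S = Suc m" "S \<subseteq> torsion G"
    using infinite_arbitrarily_large by blast
  obtain n where n: "n \<ge> 1" "p n = m * \<tau> n" "\<And>x. x \<in> S \<Longrightarrow> int (\<tau> n) dvd f n x"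
    "\<And>x y. x \<in> S \<Longrightarrow> y \<in> S \<Longrightarrow> [f n x = f n y] (mod int (p n)) \<Longrightarrow> x = y"
    using ex_level[OF S(1,3)] by blast
  have \<tau>: "\<tau> n \<ge> 1"
    using p_pos[OF n(1)] n(2) by (cases "\<tau> n") auto
  have "inj_on (\<lambda>x. (f n x div int (\<tau> n)) mod int m) S"
  proof (rule inj_onI)
    fix x y assume xy: "x \<in> S" "y \<in> S" "(f n x div int (\<tau> n)) mod int m = (f n y div int (\<tau> n)) mod int m"
    then obtain a b where ab: "f n x = int (\<tau> n) * a" "f n y = int (\<tau> n) * b"
      using n(3) by (meson dvdE)
    then have "int m dvd a - b"
      using xy(3) \<tau> by (simp add: mod_eq_dvd_iff)
    then have "int (p n) dvd int (\<tau> n) * (a - b)"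
      by (simp add: n(2) mult.commute[of "int m"])
    then show "x = y"
      using xy ab by (intro n(4)) (simp_all add: cong_iff_dvd_diff algebra_simps)
  qed
  then have "card S \<le> card {0..<int m}"
    using m by (intro card_inj_on_le) auto
  then show False using S(2) by simp
qed

text \<open>The torsion group being finite, \<open>ex_level\<close> applies to all of it, and one
  coordinate embeds it in a cyclic group.\<close>

lemma cyclic_torsion: "cyclic_group (G\<lparr>carrier := torsion G\<rparr>)"
proof -
  obtain n where n: "n \<ge> 1" "p n = m * \<tau> n" "\<And>x. x \<in> torsion G \<Longrightarrow> int (\<tau> n) dvd f n x"
    "\<And>x y. x \<in> torsion G \<Longrightarrow> y \<in> torsion G \<Longrightarrow> [f n x = f n y] (mod int (p n)) \<Longrightarrow> x = y"
    using ex_level[OF finite_torsion order_refl] by blast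
  interpret T: group "G\<lparr>carrier := torsion G\<rparr>"
    by (rule subgroup_imp_group[OF torsion_subgroup])
  interpret h: cong_hom "G\<lparr>carrier := torsion G\<rparr>" "f n" "int (p n)"
    using n(1) by unfold_locales (simp add: f_mult torsion_def)
  show ?thesis
  proof (rule h.cyclic_group_if_inj)
    fix x assume "x \<in> carrier (G\<lparr>carrier := torsion G\<rparr>)" "[f n x = 0] (mod int (p n))"
    then have "x \<in> torsion G" "[f n x = f n \<one>] (mod int (p n))"
      using cong_trans[OF _ cong_sym[OF h.one]] by auto
    then show "x = \<one>\<^bsub>G\<lparr>carrier := torsion G\<rparr>\<^esub>"
      using n(4)[OF _ subgroup.one_closed[OF torsion_subgroup]] by simp
  qed
qed

text \<open>The cardinality is the order of a generator, whose \<open>m\<close>-th power is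
  trivial.\<close>

lemma card_torsion: "card (torsion G) dvd m"
proof -
  interpret T: group "G\<lparr>carrier := torsion G\<rparr>"
    by (rule subgroup_imp_group[OF torsion_subgroup])
  obtain g where g: "g \<in> torsion G" "torsion G = range (\<lambda>k::int. g [^]\<^bsub>G\<lparr>carrier := torsion G\<rparr>\<^esub> k)"
    using cyclic_torsion unfolding T.cyclic_group by auto
  have "generate (G\<lparr>carrier := torsion G\<rparr>) {g} = torsion G"
    using T.generate_pow[of g] g by auto
  then have "card (torsion G) = T.ord g"
    using T.generate_pow_card[of g] g(1) by simp
  moreover have "g [^]\<^bsub>G\<lparr>carrier := torsion G\<rparr>\<^esub> m = \<one>"
    using torsionD(1)[OF g(1)] nat_pow_consistent by simp
  ultimately show ?thesis
    using T.pow_eq_id[of g m] g(1) by simp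
qed

text \<open>Commutativity makes multiplication a homomorphism, the infinite order of
  \<open>\<sigma>\<close> makes it injective, and \<open>decompose\<close> makes it
  surjective.\<close>

lemma direct_sum_torsion: "internal_direct_sum G (generate G {\<sigma>}) (torsion G)"
proof -
  let ?H = "generate G {\<sigma>}"
  interpret T: subgroup "torsion G" G
    by (rule torsion_subgroup)
  have H: "subgroup ?H G"
    using \<sigma> by (intro generate_is_subgroup) auto
  interpret H: subgroup ?H G by (fact H)
  have pow: "?H = range (\<lambda>k::int. \<sigma> [^] k)"
    using generate_pow[OF \<sigma>] by auto
  have inter: "h = \<one>" if "h \<in> ?H" "h \<in> torsion G" for h
    using that int_pow_\<sigma>_torsionD unfolding pow by fastforce
  interpret C: comm_group G by (rule comm_group)
  have "(\<lambda>(x, y). x \<otimes> y) \<in> hom (G\<lparr>carrier := ?H\<rparr> \<times>\<times> G\<lparr>carrier := torsion G\<rparr>) G"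
    by (auto simp: hom_def C.m_ac)
  moreover have "inj_on (\<lambda>(x, y). x \<otimes> y) (?H \<times> torsion G)"
  proof (rule inj_onI, clarify)
    fix a b c d assume mem: "a \<in> ?H" "b \<in> torsion G" "c \<in> ?H" "d \<in> torsion G"
      and eq: "a \<otimes> b = c \<otimes> d"
    then have car: "a \<in> carrier G" "b \<in> carrier G" "c \<in> carrier G" "d \<in> carrier G"
      by auto
    have "inv c \<otimes> a = inv c \<otimes> (a \<otimes> b) \<otimes> inv b"
      using car by (simp add: m_assoc)
    also have "\<dots> = d \<otimes> inv b"
      using car by (simp add: eq m_assoc[symmetric])
    finally have e: "inv c \<otimes> a = d \<otimes> inv b" .
    have "inv c \<otimes> a = \<one>"
    proof (rule inter)
      show "inv c \<otimes> a \<in> ?H" using mem by simp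
      show "inv c \<otimes> a \<in> torsion G" unfolding e using mem by simp
    qed
    then have "a = c"
      using car by (metis inv_closed inv_equality inv_inv)
    with eq car show "a = c \<and> b = d" by simp
  qed
  moreover have "x \<in> (\<lambda>(x, y). x \<otimes> y) ` (?H \<times> torsion G)" if x: "x \<in> carrier G" for x
  proof -
    obtain i :: int where i: "\<sigma> [^] i \<otimes> x \<in> torsion G"
      using decompose[OF x] by metis
    have "x = \<sigma> [^] (- i) \<otimes> (\<sigma> [^] i \<otimes> x)"
      using x \<sigma> by (simp add: int_pow_neg m_assoc[symmetric])
    moreover have "\<sigma> [^] (- i) \<in> ?H"
      unfolding pow by blast
    ultimately show ?thesis using i by force
  qed
  ultimately show ?thesis
    using H torsion_subgroup
    by (auto simp: internal_direct_sum_def iso_def bij_betw_def DirProd_def)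
qed

lemma carrier_eq_generate:
  assumes "m = 1"
  shows "carrier G = generate G {\<sigma>}"
proof
  show "generate G {\<sigma>} \<subseteq> carrier G"
    using \<sigma> by (intro generate_incl) simp
  show "carrier G \<subseteq> generate G {\<sigma>}"
  proof
    fix x assume x: "x \<in> carrier G"
    obtain i :: int where "(\<sigma> [^] i \<otimes> x) [^] m = \<one>"
      using decompose[OF x] by metis
    then have "\<sigma> [^] i \<otimes> x = \<one>"
      using assms x \<sigma> by simp
    then have "x \<otimes> \<sigma> [^] i = \<one>"
      using inv_comm x \<sigma> by simp
    then have "x = \<sigma> [^] (- i)"
      using x \<sigma> by (simp add: int_pow_neg inv_equality)
    then show "x \<in> generate G {\<sigma>}"
      using generate_pow[OF \<sigma>] by blast
  qed
qed

end

end

section \<open>Limits inferior, minimal periods and cylinder sets\<close>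

text \<open>A sequence of naturals taking each value only finitely often tends to infinity. So some
  value recurs infinitely often, and the least such value is the limit inferior.\<close>

lemma liminf_nat_attained:
  fixes u :: "nat \<Rightarrow> nat"
  assumes "liminf (\<lambda>n. ereal (real (u n))) < \<infinity>"
  obtains m where "liminf (\<lambda>n. ereal (real (u n))) = ereal (real m)" "infinite {n. u n = m}"
proof -
  have "\<exists>m. infinite {n. u n = m}"
  proof (rule ccontr)
    assume "\<not> ?thesis"
    then have "eventually (\<lambda>n. u n \<noteq> m) sequentially" for m
      by (simp add: eventually_cofinite flip: cofinite_eq_sequentially)
    then have "eventually (\<lambda>n. \<forall>m\<in>{..<k}. u n \<noteq> m) sequentially" for k
      by (intro eventually_ball_finite) auto
    then have "eventually (\<lambda>n. k \<le> u n) sequentially" for k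
      by (rule eventually_mono[of "\<lambda>n. \<forall>m\<in>{..<k}. u n \<noteq> m"]) (metis lessThan_iff not_less)
    then have "filterlim u at_top sequentially"
      unfolding filterlim_at_top by blast
    then have "filterlim (\<lambda>n. real (u n)) at_top sequentially"
      by (rule filterlim_compose[OF filterlim_real_sequentially])
    then have "((\<lambda>n. ereal (real (u n))) \<longlongrightarrow> \<infinity>) sequentially"
      by (simp add: tendsto_PInfty_eq_at_top)
    then show False
      using assms lim_imp_Liminf[OF sequentially_bot] by fastforce
  qed
  then obtain m where m: "infinite {n. u n = m}" and min: "\<And>k. k < m \<Longrightarrow> finite {n. u n = k}"
    using exists_least_iff[of "\<lambda>m. infinite {n. u n = m}"] by blast
  have "liminf (\<lambda>n. ereal (real (u n))) = ereal (real m)"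
  proof (rule antisym)
    show "liminf (\<lambda>n. ereal (real (u n))) \<le> ereal (real m)"
    proof (rule ccontr)
      assume "\<not> ?thesis"
      then have "eventually (\<lambda>n. ereal (real m) < ereal (real (u n))) sequentially"
        by (intro less_LiminfD) simp
      then have "eventually (\<lambda>n. u n \<noteq> m) sequentially"
        by (rule eventually_mono) auto
      then show False
        using m by (simp add: eventually_cofinite flip: cofinite_eq_sequentially)
    qed
    have "eventually (\<lambda>n. \<forall>k\<in>{..<m}. u n \<noteq> k) sequentially"
      using min by (intro eventually_ball_finite)
        (auto simp: eventually_cofinite simp flip: cofinite_eq_sequentially)
    then have "eventually (\<lambda>n. ereal (real m) \<le> ereal (real (u n))) sequentially"
      by (rule eventually_mono) (metis ereal_less_eq(3) lessThan_iff not_less of_nat_le_iff)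
    then show "ereal (real m) \<le> liminf (\<lambda>n. ereal (real (u n)))"
      by (rule Liminf_bounded)
  qed
  then show thesis using that m by blast
qed

text \<open>The known period \<open>q\<close> guarantees that a least one exists. The remainder of
  any period \<open>t\<close>, of either sign, modulo the least one is again a period, so it is
  0.\<close>

lemma min_period:
  fixes S :: "int set" and q :: nat
  assumes q: "q \<ge> 1" "\<And>k. k + int q \<in> S \<longleftrightarrow> k \<in> S"
  shows min_period_pos: "min_period S \<ge> 1"
    and min_period_dvd: "\<And>t. (\<And>k. k + t \<in> S \<longleftrightarrow> k \<in> S) \<Longrightarrow> int (min_period S) dvd t"
proof -
  define P where "P = (\<lambda>t::nat. t \<ge> 1 \<and> (\<forall>k. k + int t \<in> S \<longleftrightarrow> k \<in> S))"
  define m where "m = min_period S"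
  have "P q" using q by (simp add: P_def)
  moreover have m_def': "m = (LEAST t. P t)"
    by (simp add: m_def min_period_def P_def)
  ultimately have Pm: "P m"
    using LeastI by metis
  have min: "m \<le> t" if "P t" for t
    unfolding m_def' using that by (rule Least_le)
  show "min_period S \<ge> 1"
    using Pm by (simp add: P_def m_def)
  fix t :: int assume t: "k + t \<in> S \<longleftrightarrow> k \<in> S" for k
  have mult: "k + int m * j \<in> S \<longleftrightarrow> k \<in> S" for k j
  proof (induction j rule: int_induct[where k=0])
    case (step1 i)
    then show ?case
      using Pm by (metis P_def add.assoc distrib_left mult.right_neutral)
  next
    case (step2 i)
    have "k + int m * (i - 1) + int m = k + int m * i"
      by (simp add: algebra_simps)
    then show ?case
      using Pm step2 unfolding P_def by metis
  qed simp
  have "k + t mod int m \<in> S \<longleftrightarrow> k \<in> S" for k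
  proof -
    have "k + t mod int m + int m * (t div int m) = k + t"
      by simp
    then show ?thesis using mult t by metis
  qed
  moreover have bnd: "0 \<le> t mod int m" "t mod int m < int m"
    using Pm by (auto simp: P_def)
  ultimately have "\<not> P (nat (t mod int m)) \<Longrightarrow> t mod int m = 0"
    by (auto simp: P_def)
  moreover have "\<not> P (nat (t mod int m))"
    using min[of "nat (t mod int m)"] bnd by linarith
  ultimately show "int (min_period S) dvd t"
    by (simp add: m_def[symmetric] mod_eq_0_iff_dvd)
qed

section \<open>Cylinder sets and compactness of the full shift\<close>

lemma open_cylinder: "finite K \<Longrightarrow> open {y :: int \<Rightarrow> bool. \<forall>k\<in>K. y k = x k}"
  using product_topology_basis'[of K "\<lambda>k. {x k}" id] by (simp add: open_discrete)

lemma open_contains_cylinder: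
  fixes U :: "(int \<Rightarrow> bool) set"
  assumes "open U" "x \<in> U"
  obtains r :: int where "{y. \<forall>k. \<bar>k\<bar> \<le> r \<longrightarrow> y k = x k} \<subseteq> U"
proof -
  obtain V where V: "finite {i. V i \<noteq> (UNIV :: bool set)}" "x \<in> PiE UNIV V" "PiE UNIV V \<subseteq> U"
    using product_topology_open_contains_basis[of "\<lambda>_. euclidean" UNIV U x] assms
    by (auto simp: euclidean_product_topology)
  obtain r where r: "\<And>i. V i \<noteq> UNIV \<Longrightarrow> \<bar>i\<bar> \<le> r"
    using V(1) unfolding finite_int_iff_bounded_le by auto
  have "y \<in> PiE UNIV V" if "\<forall>k. \<bar>k\<bar> \<le> r \<longrightarrow> y k = x k" for y
    using that r V(2) by (fastforce simp: PiE_UNIV_domain Pi_iff)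
  then show thesis using that[of r] V(3) by blast
qed

lemma compact_UNIV_bool_fun: "compact (UNIV :: ('a \<Rightarrow> bool) set)"
proof -
  have "compact_space (product_topology (\<lambda>_. euclidean :: bool topology) (UNIV :: 'a set))"
    by (intro compact_space_product_topology[THEN iffD2] disjI2 ballI)
      (simp add: compact_space_def finite_imp_compact)
  then show ?thesis
    by (simp add: euclidean_product_topology compact_space_def)
qed

section \<open>Toeplitz subshifts over an odometer\<close>

lemma mem_progression: "j \<in> progression k m \<longleftrightarrow> [j = k] (mod int m)"
proof -
  have "j \<in> progression k m \<longleftrightarrow> (\<exists>c. j - k = int m * c)"
    unfolding progression_def image_iff by (simp add: algebra_simps)
  then show ?thesis
    by (simp add: cong_iff_dvd_diff dvd_def)
qed

lemma mem_holes_iff: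
  "k \<in> holes \<eta> p n \<longleftrightarrow>
    (\<exists>a b. [a = k] (mod int (p n)) \<and> [b = k] (mod int (p n)) \<and> \<eta> a \<noteq> \<eta> b)"
proof
  assume "k \<in> holes \<eta> p n"
  then have nc: "\<not> (\<exists>y. \<forall>a\<in>progression k (p n). \<eta> a = y)"
    by (simp add: holes_def constant_on_def)
  then obtain a where "a \<in> progression k (p n)" "\<not> \<eta> a"
    by blast
  moreover obtain b where "b \<in> progression k (p n)" "\<eta> b"
    using nc by blast
  ultimately show "\<exists>a b. [a = k] (mod int (p n)) \<and> [b = k] (mod int (p n)) \<and> \<eta> a \<noteq> \<eta> b"
    unfolding mem_progression by blast
next
  assume "\<exists>a b. [a = k] (mod int (p n)) \<and> [b = k] (mod int (p n)) \<and> \<eta> a \<noteq> \<eta> b"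
  then obtain a b where "a \<in> progression k (p n)" "b \<in> progression k (p n)" "\<eta> a \<noteq> \<eta> b"
    unfolding mem_progression by blast
  then have "\<not> \<eta> constant_on progression k (p n)"
    unfolding constant_on_def by (auto dest!: bspec)
  then show "k \<in> holes \<eta> p n"
    by (simp add: holes_def)
qed

lemma mem_orbit_closure: "\<eta> \<in> orbit_closure \<eta>"
proof -
  have "\<eta> \<in> range (\<lambda>n::int. \<lambda>k. \<eta> (k + n))"
    by (rule range_eqI[of _ _ 0]) simp
  then show ?thesis
    unfolding orbit_closure_def by (rule subsetD[OF closure_subset])
qed

lemma continuous_on_translate:
  "continuous_on S (\<lambda>x k. x (k + m))" for m :: int and S :: "(int \<Rightarrow> bool) set"
  by (rule continuous_on_coordinatewise_then_product,
      rule continuous_on_product_then_coordinatewise[OF continuous_on_id])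

text \<open>\<open>\<phi> n\<close> is the level \<open>n\<close> coordinate of a map to the
  odometer, normalised so that \<open>\<eta>\<close> lies over 0. Openness of its level sets
  expresses continuity; compatibility with the shift and between levels is required only modulo
  \<open>p n\<close>.\<close>

locale toeplitz_rotation =
  fixes \<eta> :: "int \<Rightarrow> bool" and p :: "nat \<Rightarrow> nat" and \<phi> :: "nat \<Rightarrow> (int \<Rightarrow> bool) \<Rightarrow> int"
  assumes toeplitz: "nonperiodic_toeplitz \<eta> p"
    and \<phi>_open: "\<And>n c. n \<ge> 1 \<Longrightarrow>
      openin (top_of_set (orbit_closure \<eta>)) {x \<in> orbit_closure \<eta>. \<phi> n x = c}"
    and \<phi>_shift: "\<And>n x. n \<ge> 1 \<Longrightarrow> x \<in> orbit_closure \<eta> \<Longrightarrow>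
      [\<phi> n (shift x) = \<phi> n x + 1] (mod int (p n))"
    and \<phi>_Suc: "\<And>n x. n \<ge> 1 \<Longrightarrow> x \<in> orbit_closure \<eta> \<Longrightarrow>
      [\<phi> (Suc n) x = \<phi> n x] (mod int (p n))"
    and \<phi>_\<eta>: "\<And>n. n \<ge> 1 \<Longrightarrow> \<phi> n \<eta> = 0"
begin

abbreviation "X \<equiv> orbit_closure \<eta>"

abbreviation "G \<equiv> Aut (top_of_set X) shift"

abbreviation "H n \<equiv> holes \<eta> p n"

abbreviation "E n \<equiv> essential_holes \<eta> p n"

lemma p_pos: "n \<ge> 1 \<Longrightarrow> p n \<ge> 1"
  and p_Suc: "n \<ge> 1 \<Longrightarrow> p n dvd p (Suc n)"
  and p_lim: "filterlim p at_top sequentially"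
  and nonperiodic: "\<not> periodic_seq \<eta>"
  and eta_const: "\<exists>n\<ge>1. \<eta> constant_on progression k (p n)"
  using toeplitz unfolding nonperiodic_toeplitz_def by blast+

lemma p_dvd: "1 \<le> n \<Longrightarrow> n \<le> n' \<Longrightarrow> p n dvd p n'"
  by (rule dvd_chain[of p, OF p_Suc])

lemma translate_in:
  assumes "x \<in> X"
  shows "(\<lambda>k. x (k + m)) \<in> X"
proof -
  have "(\<lambda>x k. x (k + m)) ` closure (range (\<lambda>n::int. \<lambda>k. \<eta> (k + n)))
      \<subseteq> closure (range (\<lambda>n::int. \<lambda>k. \<eta> (k + n)))"
  proof (rule image_closure_subset)
    show "continuous_on (closure (range (\<lambda>n::int. \<lambda>k. \<eta> (k + n)))) (\<lambda>x k. x (k + m))"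
      by (rule continuous_on_translate)
    have "(\<lambda>k. \<eta> (k + m + n)) \<in> range (\<lambda>n::int. \<lambda>k. \<eta> (k + n))" for n
      by (rule range_eqI[of _ _ "m + n"]) (simp add: add.assoc)
    then have "(\<lambda>x k. x (k + m)) ` range (\<lambda>n::int. \<lambda>k. \<eta> (k + n)) \<subseteq> range (\<lambda>n::int. \<lambda>k. \<eta> (k + n))"
      by (intro image_subsetI) (elim rangeE, simp)
    then show "(\<lambda>x k. x (k + m)) ` range (\<lambda>n::int. \<lambda>k. \<eta> (k + n))
        \<subseteq> closure (range (\<lambda>n::int. \<lambda>k. \<eta> (k + n)))"
      by (rule order_trans[OF _ closure_subset])
  qed simp
  then show ?thesis
    using assms unfolding orbit_closure_def by blast
qed

lemma orbit_in: "(\<lambda>k. \<eta> (k + m)) \<in> X"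
  by (rule translate_in[OF mem_orbit_closure])

lemma shift_in: "x \<in> X \<Longrightarrow> shift x \<in> X"
  unfolding shift_def by (rule translate_in)

lemma shift_translate: "shift (\<lambda>k. x (k + m)) = (\<lambda>k. x (k + (m + 1)))"
  by (simp add: shift_def add_ac)

lemma orbit_dense:
  assumes "openin (top_of_set X) V" "x \<in> V"
  obtains m where "(\<lambda>k. \<eta> (k + m)) \<in> V"
proof -
  obtain T where T: "open T" "V = X \<inter> T"
    using assms(1) by (auto simp: openin_open)
  then have "range (\<lambda>n::int. \<lambda>k. \<eta> (k + n)) \<inter> T \<noteq> {}"
    using assms(2) open_Int_closure_eq_empty[of T "range (\<lambda>n::int. \<lambda>k. \<eta> (k + n))"]
    by (auto simp: orbit_closure_def)
  then show thesis
    using that T(2) orbit_in by blast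
qed

lemma \<phi>_translate:
  assumes n: "n \<ge> 1" and x: "x \<in> X"
  shows "[\<phi> n (\<lambda>k. x (k + m)) = \<phi> n x + m] (mod int (p n))"
proof (induction m rule: int_induct[where k=0])
  case (step1 i)
  have "[\<phi> n (\<lambda>k. x (k + (i + 1))) = \<phi> n (\<lambda>k. x (k + i)) + 1] (mod int (p n))"
    using \<phi>_shift[OF n translate_in[OF x, of i]] by (simp add: shift_translate)
  also have "[\<phi> n (\<lambda>k. x (k + i)) + 1 = \<phi> n x + i + 1] (mod int (p n))"
    using step1 by (intro cong_add cong_refl)
  finally show ?case by (simp add: add_ac)
next
  case (step2 i)
  have "[\<phi> n (\<lambda>k. x (k + i)) = \<phi> n (\<lambda>k. x (k + (i - 1))) + 1] (mod int (p n))"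
    using \<phi>_shift[OF n translate_in[OF x, of "i - 1"]] by (simp add: shift_translate)
  then have "[\<phi> n (\<lambda>k. x (k + (i - 1))) + 1 = (\<phi> n x + (i - 1)) + 1] (mod int (p n))"
    using step2 cong_sym cong_trans by (metis add.assoc diff_add_cancel)
  then show ?case
    by (simp only: cong_add_rcancel)
qed simp

lemma \<phi>_orbit: "n \<ge> 1 \<Longrightarrow> [\<phi> n (\<lambda>k. \<eta> (k + m)) = m] (mod int (p n))"
  using \<phi>_translate[OF _ mem_orbit_closure, of n m] \<phi>_\<eta> by simp

text \<open>Level sets of \<open>\<phi> n\<close> and cylinders are open and the orbit is dense, so
  some translate of \<open>\<eta>\<close> over the same residue agrees with \<open>x\<close> on
  \<open>K\<close>. In this way values of points of \<open>X\<close> are read off from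
  \<open>\<eta>\<close>.\<close>

lemma approximation:
  assumes "n \<ge> 1" "x \<in> X" "finite K"
  obtains m where "[\<phi> n x = m] (mod int (p n))" "\<And>k. k \<in> K \<Longrightarrow> x k = \<eta> (k + m)"
proof -
  have "openin (top_of_set X) ({y \<in> X. \<phi> n y = \<phi> n x} \<inter> (X \<inter> {y. \<forall>k\<in>K. y k = x k}))"
    using assms by (intro openin_Int \<phi>_open openin_open_Int open_cylinder)
  then obtain m where "(\<lambda>k. \<eta> (k + m)) \<in> {y \<in> X. \<phi> n y = \<phi> n x} \<inter> (X \<inter> {y. \<forall>k\<in>K. y k = x k})"
    by (rule orbit_dense[of _ x]) (use assms in auto)
  then show thesis
    using that[of m] \<phi>_orbit[OF assms(1), of m] by auto
qed

lemma compact_X: "compact X"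
  using compact_Int_closed[OF compact_UNIV_bool_fun, of X] by (simp add: orbit_closure_def)

text \<open>The Curtis-Hedlund-Lyndon argument: the coordinate at 0 is locally constant, and
  compactness gives one radius for all points.\<close>

lemma block_code:
  assumes "continuous_on X F"
  obtains r :: int where
    "\<And>x y. x \<in> X \<Longrightarrow> y \<in> X \<Longrightarrow> (\<And>k. \<bar>k\<bar> \<le> r \<Longrightarrow> x k = y k) \<Longrightarrow> F x 0 = (F y 0 :: bool)"
proof -
  have cont: "continuous_on X (\<lambda>x. F x 0)"
    using assms by (rule continuous_on_product_then_coordinatewise)
  have "\<exists>r::int. \<forall>y\<in>X. (\<forall>k. \<bar>k\<bar> \<le> r \<longrightarrow> y k = x k) \<longrightarrow> F y 0 = F x 0" if x: "x \<in> X" for x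
  proof -
    have "openin (top_of_set X) (X \<inter> (\<lambda>x. F x 0) -` {F x 0})"
      by (rule continuous_openin_preimage_gen[OF cont]) (rule open_discrete)
    then obtain T where T: "open T" "X \<inter> (\<lambda>x. F x 0) -` {F x 0} = X \<inter> T"
      by (auto simp: openin_open)
    then have "x \<in> T" using x by auto
    then obtain r :: int where "{y. \<forall>k. \<bar>k\<bar> \<le> r \<longrightarrow> y k = x k} \<subseteq> T"
      using open_contains_cylinder[OF T(1)] by blast
    then show ?thesis
      using T(2) by (intro exI[of _ r]) blast
  qed
  then obtain R :: "(int \<Rightarrow> bool) \<Rightarrow> int" where
    R: "\<And>x y. x \<in> X \<Longrightarrow> y \<in> X \<Longrightarrow> (\<forall>k. \<bar>k\<bar> \<le> R x \<longrightarrow> y k = x k) \<Longrightarrow> F y 0 = F x 0"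
    by metis
  define C where "C = (\<lambda>x. {y :: int \<Rightarrow> bool. \<forall>k\<in>{- R x..R x}. y k = x k})"
  have "open (C x)" for x
    unfolding C_def by (rule open_cylinder) simp
  moreover have "X \<subseteq> \<Union> (C ` X)"
    by (auto simp: C_def)
  \<comment> \<open>Points that agree up to the largest radius over \<open>D\<close> agree with a
    common centre within the radius of that centre.\<close>
  ultimately obtain D where D: "D \<subseteq> X" "finite D" "X \<subseteq> \<Union> (C ` D)"
    using compactE_image[OF compact_X] by metis
  obtain r where r: "\<And>x. x \<in> D \<Longrightarrow> R x \<le> r"
    using bdd_above_finite[of "R ` D"] D(2) by (auto simp: bdd_above_def)
  show thesis
  proof (rule that[of r])
    fix x y assume xy: "x \<in> X" "y \<in> X" "\<And>k. \<bar>k\<bar> \<le> r \<Longrightarrow> x k = y k"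
    obtain z where z: "z \<in> D" "x \<in> C z"
      using D(3) xy(1) by blast
    have xz: "x k = z k" if "\<bar>k\<bar> \<le> R z" for k
      using z(2) that by (auto simp: C_def abs_le_iff)
    moreover have "y k = z k" if "\<bar>k\<bar> \<le> R z" for k
      using xz[OF that] xy(3)[of k] r[OF z(1)] that by auto
    ultimately show "F x 0 = F y 0"
      using R[of z x] R[of z y] xy z D(1) by blast
  qed
qed

end

section \<open>Automorphisms as odometer translations\<close>

lemma Aut_eq: "Aut X T = BijGroup (topspace X)\<lparr>carrier := carrier (Aut X T)\<rparr>"
  by (simp add: Aut_def)

lemma mem_carrier_Aut:
  "f \<in> carrier (Aut X T) \<longleftrightarrow>
    f \<in> Bij (topspace X) \<and> homeomorphic_map X X f \<and> (\<forall>x\<in>topspace X. f (T x) = T (f x))"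
  by (simp add: Aut_def)

lemma one_Aut: "\<one>\<^bsub>Aut X T\<^esub> = (\<lambda>x\<in>topspace X. x)"
  by (simp add: Aut_def BijGroup_def)

lemma mult_Aut:
  "f \<in> carrier (Aut X T) \<Longrightarrow> g \<in> carrier (Aut X T) \<Longrightarrow>
    f \<otimes>\<^bsub>Aut X T\<^esub> g = compose (topspace X) f g"
  by (simp add: Aut_def BijGroup_def)

lemma subgroup_Aut:
  assumes T: "T \<in> topspace X \<rightarrow> topspace X"
  shows "subgroup (carrier (Aut X T)) (BijGroup (topspace X))"
proof
  show "carrier (Aut X T) \<subseteq> carrier (BijGroup (topspace X))"
    by (auto simp: mem_carrier_Aut BijGroup_def)
next
  fix f g assume fg: "f \<in> carrier (Aut X T)" "g \<in> carrier (Aut X T)"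
  then have bij: "f \<in> Bij (topspace X)" "g \<in> Bij (topspace X)"
    by (auto simp: mem_carrier_Aut)
  have "compose (topspace X) f g \<in> carrier (Aut X T)"
    unfolding mem_carrier_Aut
  proof (intro conjI ballI)
    show "compose (topspace X) f g \<in> Bij (topspace X)"
      using bij by (rule compose_Bij)
    have "homeomorphic_map X X (f \<circ> g)"
      using fg by (intro homeomorphic_map_compose[of X X g X f]) (auto simp: mem_carrier_Aut)
    then show "homeomorphic_map X X (compose (topspace X) f g)"
      by (rule homeomorphic_map_eq) (simp add: compose_def)
    fix x assume x: "x \<in> topspace X"
    have "g x \<in> topspace X"
      using Bij_imp_funcset[OF bij(2)] x by blast
    moreover have "T x \<in> topspace X"
      using T x by blast
    ultimately show "compose (topspace X) f g (T x) = T (compose (topspace X) f g x)"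
      using fg x by (simp add: compose_def mem_carrier_Aut)
  qed
  then show "f \<otimes>\<^bsub>BijGroup (topspace X)\<^esub> g \<in> carrier (Aut X T)"
    using bij by (simp add: BijGroup_def)
next
  have "homeomorphic_map X X (\<lambda>x\<in>topspace X. x)"
    by (rule homeomorphic_map_eq[of X X id]) simp_all
  then show "\<one>\<^bsub>BijGroup (topspace X)\<^esub> \<in> carrier (Aut X T)"
    using T by (auto simp: mem_carrier_Aut BijGroup_def id_Bij)
next
  fix f assume f: "f \<in> carrier (Aut X T)"
  then have bij: "f \<in> Bij (topspace X)" and homeo: "homeomorphic_map X X f"
    and comm: "\<And>x. x \<in> topspace X \<Longrightarrow> f (T x) = T (f x)"
    by (auto simp: mem_carrier_Aut)
  let ?g = "\<lambda>x\<in>topspace X. inv_into (topspace X) f x"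
  have bb: "bij_betw f (topspace X) (topspace X)"
    using bij by (simp add: Bij_def)
  have gf: "?g (f x) = x" if "x \<in> topspace X" for x
    using bij_betw_inv_into_left[OF bb that] bij_betw_apply[OF bb that] by simp
  have "?g \<in> carrier (Aut X T)"
    unfolding mem_carrier_Aut
  proof (intro conjI ballI)
    show "?g \<in> Bij (topspace X)"
      using bij by (rule restrict_inv_into_Bij)
    obtain h where h: "homeomorphic_maps X X f h"
      using homeo homeomorphic_map_maps by blast
    have hg: "h x = ?g x" if x: "x \<in> topspace X" for x
    proof -
      obtain y where "y \<in> topspace X" "x = f y"
        using bb x by (auto simp: bij_betw_def)
      then show ?thesis
        using h gf by (simp add: homeomorphic_maps_def)
    qed
    show "homeomorphic_map X X ?g"
      using h hg homeomorphic_map_eq[of X X h ?g] unfolding homeomorphic_maps_map by blast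
    fix x assume "x \<in> topspace X"
    then obtain y where y: "y \<in> topspace X" "x = f y"
      using bb by (auto simp: bij_betw_def)
    have Ty: "T y \<in> topspace X"
      using T y by blast
    have "?g (T x) = ?g (f (T y))"
      using y comm by simp
    also have "\<dots> = T (?g x)"
      using gf[OF Ty] gf[OF y(1)] y(2) by simp
    finally show "?g (T x) = T (?g x)" .
  qed
  then show "inv\<^bsub>BijGroup (topspace X)\<^esub> f \<in> carrier (Aut X T)"
    using bij by (simp add: inv_BijGroup)
qed

lemma group_Aut: "T \<in> topspace X \<rightarrow> topspace X \<Longrightarrow> group (Aut X T)"
  using subgroup.subgroup_is_group[OF subgroup_Aut group_BijGroup] by (metis Aut_eq)

section \<open>The embedding of the automorphism group in the odometer\<close>

context toeplitz_rotation
begin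

lemma group_G: "group G"
  by (rule group_Aut) (simp add: shift_in)

lemma shift_in_G: "restrict shift X \<in> carrier G"
proof -
  have "homeomorphic_maps (top_of_set X) (top_of_set X) shift (\<lambda>x k. x (k + - 1))"
    using continuous_on_translate[of X 1] continuous_on_translate[of X "- 1"]
      translate_in[of _ 1] translate_in[of _ "- 1"] by (auto simp: homeomorphic_maps_def shift_def[abs_def])
  then have "homeomorphic_map (top_of_set X) (top_of_set X) shift"
    by (rule homeomorphic_maps_imp_map)
  then have homeo: "homeomorphic_map (top_of_set X) (top_of_set X) (restrict shift X)"
    by (rule homeomorphic_map_eq) simp
  then have "bij_betw (restrict shift X) X X"
    by (auto simp: homeomorphic_eq_everything_map bij_betw_def)
  then show ?thesis
    using homeo by (auto simp: mem_carrier_Aut Bij_def shift_in)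
qed

lemma
  assumes "F \<in> carrier G"
  shows G_in: "x \<in> X \<Longrightarrow> F x \<in> X"
    and G_continuous: "continuous_on X F"
    and G_shift: "x \<in> X \<Longrightarrow> F (shift x) = shift (F x)"
    and G_extensional: "x \<notin> X \<Longrightarrow> F x = undefined"
  using assms homeomorphic_imp_continuous_map[of "top_of_set X" "top_of_set X" F]
  by (auto simp: mem_carrier_Aut Bij_def extensional_def)

lemma G_translate:
  assumes F: "F \<in> carrier G" and x: "x \<in> X"
  shows "F (\<lambda>k. x (k + m)) = (\<lambda>k. F x (k + m))"
proof (induction m rule: int_induct[where k=0])
  case (step1 i)
  have "F (\<lambda>k. x (k + (i + 1))) = shift (F (\<lambda>k. x (k + i)))"
    using G_shift[OF F translate_in[OF x, of i]] by (simp add: shift_translate)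
  then show ?case
    by (simp add: step1 shift_translate)
next
  case (step2 i)
  have "shift (F (\<lambda>k. x (k + (i - 1)))) = (\<lambda>k. F x (k + i))"
    using G_shift[OF F translate_in[OF x, of "i - 1"]] step2 by (simp add: shift_translate)
  then have "F (\<lambda>k. x (k + (i - 1))) (j - 1 + 1) = F x (j - 1 + i)" for j
    unfolding shift_def by (rule fun_cong)
  moreover have "j - 1 + 1 = j" "j - 1 + i = j + (i - 1)" for j
    by simp_all
  ultimately show ?case
    by metis
qed simp

text \<open>The automorphism \<open>F\<close> acts on the odometer as the translation by \<open>(rot n F)\<^sub>n\<close>.\<close>

definition rot :: "nat \<Rightarrow> ((int \<Rightarrow> bool) \<Rightarrow> int \<Rightarrow> bool) \<Rightarrow> int" where
  "rot n F = \<phi> n (F \<eta>)"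

text \<open>On the orbit of \<open>\<eta>\<close> the difference of the two coordinates is constant
  modulo \<open>p n\<close>, because \<open>F\<close> commutes with translates. Both coordinates are
  locally constant, so density of the orbit extends this to \<open>X\<close>.\<close>

lemma \<phi>_G:
  assumes n: "n \<ge> 1" and F: "F \<in> carrier G" and x: "x \<in> X"
  shows "[\<phi> n (F x) = \<phi> n x + rot n F] (mod int (p n))"
proof -
  let ?V = "{y \<in> X. \<phi> n y = \<phi> n x} \<inter> (X \<inter> F -` {y \<in> X. \<phi> n y = \<phi> n (F x)})"
  have "openin (top_of_set X) ?V"
    using n by (intro openin_Int \<phi>_open continuous_openin_preimage[OF G_continuous[OF F], of X])
      (auto simp: G_in[OF F])
  then obtain m where m: "(\<lambda>k. \<eta> (k + m)) \<in> ?V"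
    by (rule orbit_dense[of _ x]) (use x G_in[OF F x] in auto)
  then have "\<phi> n (F x) = \<phi> n (\<lambda>k. F \<eta> (k + m))" "\<phi> n x = \<phi> n (\<lambda>k. \<eta> (k + m))"
    using G_translate[OF F mem_orbit_closure] by auto
  then have "[\<phi> n (F x) = \<phi> n (F \<eta>) + m] (mod int (p n))" "[\<phi> n x = m] (mod int (p n))"
    using \<phi>_translate[OF n G_in[OF F mem_orbit_closure], of m] \<phi>_orbit[OF n, of m] by auto
  then show ?thesis
    unfolding rot_def using cong_add[OF cong_sym cong_refl, of "\<phi> n x" m] cong_trans
    by (metis add.commute)
qed

text \<open>The fibre over 0 contains only \<open>\<eta>\<close>: at index \<open>k\<close>, use a
  level at which \<open>\<eta>\<close> is constant along the progression of \<open>k\<close>. So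
  \<open>F\<close> fixes \<open>\<eta>\<close>, hence its orbit, hence all of \<open>X\<close> by
  density.\<close>

lemma G_eq_one:
  assumes F: "F \<in> carrier G" and zero: "\<And>n. n \<ge> 1 \<Longrightarrow> [rot n F = 0] (mod int (p n))"
  shows "F = \<one>\<^bsub>G\<^esub>"
proof -
  have "F \<eta> k = \<eta> k" for k
  proof -
    obtain n where n: "n \<ge> 1" "\<eta> constant_on progression k (p n)"
      using eta_const by blast
    obtain m where m: "[\<phi> n (F \<eta>) = m] (mod int (p n))" "F \<eta> k = \<eta> (k + m)"
      using approximation[OF n(1) G_in[OF F mem_orbit_closure], of "{k}"] by blast
    have "[m = 0] (mod int (p n))"
      using m(1) zero[OF n(1)] cong_sym cong_trans unfolding rot_def by blast
    then have "[k + m = k + 0] (mod int (p n))"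
      by (intro cong_add cong_refl)
    then have "k + m \<in> progression k (p n)" "k \<in> progression k (p n)"
      by (auto simp: mem_progression)
    then have "\<eta> (k + m) = \<eta> k"
      using n(2) unfolding constant_on_def by metis
    then show ?thesis using m by simp
  qed
  then have F_eta: "F \<eta> = \<eta>" ..
  have "F x k = x k" if x: "x \<in> X" for x k
  proof (rule ccontr)
    assume ne: "F x k \<noteq> x k"
    have coord: "continuous_on X (\<lambda>y. F y k)"
      by (rule continuous_on_product_then_coordinatewise[OF G_continuous[OF F]])
    \<comment> \<open>An orbit point in this open set would be moved by \<open>F\<close>.\<close>
    let ?V = "(X \<inter> (\<lambda>y. F y k) -` {F x k}) \<inter> (X \<inter> {y. \<forall>i\<in>{k}. y i = x i})"
    have "openin (top_of_set X) ?V"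
      by (intro openin_Int continuous_openin_preimage_gen[OF coord] openin_open_Int open_cylinder
          open_discrete) simp
    then obtain m where m: "(\<lambda>k. \<eta> (k + m)) \<in> ?V"
      by (rule orbit_dense[of _ x]) (use x in auto)
    then show False
      using ne G_translate[OF F mem_orbit_closure, of m] F_eta by auto
  qed
  then show ?thesis
    unfolding one_Aut using G_extensional[OF F] by (auto simp: restrict_def fun_eq_iff)
qed

text \<open>Additivity of \<open>rot n\<close> modulo \<open>p n\<close> comes from
  \<open>\<phi>_G\<close>, triviality of the joint kernel from \<open>G_eq_one\<close>.\<close>

sublocale G: odometer_rotation G p rot "restrict shift X"
proof -
  interpret group G by (rule group_G)
  show "odometer_rotation G p rot (restrict shift X)"
  proof
    show "p n dvd p (Suc n)" if "n \<ge> 1" for n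
      using p_Suc[OF that] .
    show "filterlim p at_top sequentially"
      by (rule p_lim)
    show "[rot n (F \<otimes>\<^bsub>G\<^esub> F') = rot n F + rot n F'] (mod int (p n))"
      if "n \<ge> 1" "F \<in> carrier G" "F' \<in> carrier G" for n F F'
      using \<phi>_G[OF that(1,2) G_in[OF that(3) mem_orbit_closure]] that mem_orbit_closure
      by (simp add: mult_Aut compose_def rot_def add.commute)
    show "[rot (Suc n) F = rot n F] (mod int (p n))" if "n \<ge> 1" "F \<in> carrier G" for n F
      unfolding rot_def by (rule \<phi>_Suc[OF that(1) G_in[OF that(2) mem_orbit_closure]])
    show "F = \<one>\<^bsub>G\<^esub>" if "F \<in> carrier G" "\<And>n. n \<ge> 1 \<Longrightarrow> [rot n F = 0] (mod int (p n))" for F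
      using G_eq_one that by blast
    show "restrict shift X \<in> carrier G"
      by (rule shift_in_G)
    show "[rot n (restrict shift X) = 1] (mod int (p n))" if "n \<ge> 1" for n
      using \<phi>_shift[OF that mem_orbit_closure] \<phi>_\<eta>[OF that] mem_orbit_closure by (simp add: rot_def)
  qed
qed

end

section \<open>Automorphisms and essential holes\<close>

lemma finite_bounded:
  fixes g :: "'a \<Rightarrow> 'b :: lattice"
  assumes "finite D"
  obtains b where "\<And>x. x \<in> D \<Longrightarrow> g x \<le> b"
  using bdd_above_finite[of "g ` D"] assms unfolding bdd_above_def by blast

context toeplitz_rotation
begin

section \<open>Monotonicity and existence of essential holes\<close>

lemma holes_mono:
  assumes "1 \<le> n" "n \<le> n'"
  shows "H n' \<subseteq> H n"
proof
  fix k assume "k \<in> H n'"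
  then obtain a b where "[a = k] (mod int (p n'))" "[b = k] (mod int (p n'))" "\<eta> a \<noteq> \<eta> b"
    unfolding mem_holes_iff by blast
  moreover have "int (p n) dvd int (p n')"
    using p_dvd[OF assms] by simp
  ultimately show "k \<in> H n"
    unfolding mem_holes_iff using cong_dvd_modulus by blast
qed

lemma holes_cong:
  assumes "[j = k] (mod int (p n))"
  shows "j \<in> H n \<longleftrightarrow> k \<in> H n"
proof -
  have "[a = j] (mod int (p n)) \<longleftrightarrow> [a = k] (mod int (p n))" for a
    using assms cong_sym cong_trans by blast
  then show ?thesis by (simp add: mem_holes_iff)
qed

text \<open>The clause for \<open>n = N\<close> already makes \<open>k\<close> a hole at level
  \<open>N\<close>.\<close>

lemma mem_essential_holes_iff:
  "k \<in> E N \<longleftrightarrow> (\<forall>n\<ge>N. \<exists>j\<in>H n. [j = k] (mod int (p N)))"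
proof -
  have "k \<in> H N" if "\<forall>n\<ge>N. \<exists>j\<in>H n. [j = k] (mod int (p N))"
    using that holes_cong by blast
  then show ?thesis
    unfolding essential_holes_def by (auto simp: mem_progression disjoint_iff)
qed

lemma essential_holes_cong:
  assumes "[j = k] (mod int (p N))"
  shows "j \<in> E N \<longleftrightarrow> k \<in> E N"
proof -
  have "[a = j] (mod int (p N)) \<longleftrightarrow> [a = k] (mod int (p N))" for a
    using assms cong_sym cong_trans by blast
  then show ?thesis by (simp add: mem_essential_holes_iff)
qed

lemma essential_holes_mono:
  assumes "1 \<le> N" "N \<le> N'"
  shows "E N' \<subseteq> E N"
proof
  fix k assume k: "k \<in> E N'"
  have dvd: "int (p N) dvd int (p N')"
    using p_dvd[OF assms] by simp
  show "k \<in> E N"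
    unfolding mem_essential_holes_iff
  proof (intro allI impI)
    fix n assume n: "n \<ge> N"
    \<comment> \<open>The level \<open>max n N'\<close> also covers \<open>n\<close> between
      \<open>N\<close> and \<open>N'\<close>: its holes are holes at level \<open>n\<close>.\<close>
    obtain j where j: "j \<in> H (max n N')" "[j = k] (mod int (p N'))"
      using k unfolding mem_essential_holes_iff by (meson max.cobounded2)
    have "j \<in> H n"
      using holes_mono[of n "max n N'"] j(1) n assms(1) by auto
    then show "\<exists>j\<in>H n. [j = k] (mod int (p N))"
      using cong_dvd_modulus[OF j(2) dvd] by blast
  qed
qed

lemma holes_nonempty:
  assumes "n \<ge> 1"
  shows "H n \<noteq> {}"
proof
  assume "H n = {}"
  then have const: "\<eta> constant_on progression k (p n)" for k
    by (auto simp: holes_def)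
  have "\<eta> (k + int (p n)) = \<eta> k" for k
  proof -
    have "k + int (p n) \<in> progression k (p n)" "k \<in> progression k (p n)"
      by (auto simp: mem_progression cong_iff_dvd_diff)
    then show ?thesis
      using const[of k] unfolding constant_on_def by metis
  qed
  then show False
    using nonperiodic p_pos[OF assms] unfolding periodic_seq_def by blast
qed

text \<open>If no residue class modulo \<open>p N\<close> were essential, each of these finitely
  many classes would be free of holes from some level on, and a high level would have no holes at
  all.\<close>

lemma essential_holes_nonempty:
  assumes "N \<ge> 1"
  shows "E N \<noteq> {}"
proof
  assume empty: "E N = {}"
  have "\<exists>n\<ge>N. \<forall>j\<in>H n. \<not> [j = k] (mod int (p N))" for k
    using empty mem_essential_holes_iff[of k N] by blast
  then obtain \<nu> where \<nu>: "\<And>k. \<nu> k \<ge> N" "\<And>k j. j \<in> H (\<nu> k) \<Longrightarrow> \<not> [j = k] (mod int (p N))"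
    by metis
  obtain b where b: "\<And>k. k \<in> {0..<int (p N)} \<Longrightarrow> \<nu> k \<le> b"
    by (rule finite_bounded[of "{0..<int (p N)}" \<nu>]) auto
  define n where "n = max b N"
  then have "n \<ge> 1"
    using assms by simp
  then obtain j where j: "j \<in> H n"
    using holes_nonempty[of n] by blast
  define k where "k = j mod int (p N)"
  have k: "k \<in> {0..<int (p N)}"
    using p_pos[OF assms] by (simp add: k_def)
  have "j \<in> H (\<nu> k)"
    using holes_mono[of "\<nu> k" n] j b[OF k] \<nu>(1)[of k] assms by (auto simp: n_def)
  then show False
    using \<nu>(2)[of j k] by (simp add: k_def)
qed

text \<open>\<open>r\<close> is the radius of a block code for the inverse of \<open>F\<close>: if
  \<open>F x\<close> and \<open>F y\<close> agreed on the window, \<open>x\<close> and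
  \<open>y\<close> would agree at 0.\<close>

lemma separation:
  assumes F: "F \<in> carrier G"
  obtains r :: int where "\<And>x y. x \<in> X \<Longrightarrow> y \<in> X \<Longrightarrow> x 0 \<noteq> y 0 \<Longrightarrow> \<exists>i. \<bar>i\<bar> \<le> r \<and> F x i \<noteq> F y i"
proof -
  let ?F' = "inv\<^bsub>G\<^esub> F"
  have F': "?F' \<in> carrier G"
    using F by simp
  have inv: "?F' (F x) = x" if "x \<in> X" for x
  proof -
    have "compose X ?F' F = (\<lambda>x\<in>X. x)"
      using mult_Aut[OF F' F] G.l_inv[OF F] by (simp add: one_Aut)
    then show ?thesis
      using that by (metis compose_eq restrict_apply')
  qed
  obtain r :: int where r: "\<And>x y. x \<in> X \<Longrightarrow> y \<in> X \<Longrightarrow> (\<And>k. \<bar>k\<bar> \<le> r \<Longrightarrow> x k = y k) \<Longrightarrow> ?F' x 0 = ?F' y 0"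
    using block_code[OF G_continuous[OF F']] by metis
  show thesis
    using that[of r] r[OF G_in[OF F] G_in[OF F]] inv by metis
qed

text \<open>Two translates of \<open>\<eta>\<close> over \<open>k\<close> that differ at 0 have
  images over \<open>k + rot n F\<close> that differ at some \<open>i\<close> in the window. Two
  values over one residue make a hole.\<close>

lemma holes_G:
  assumes F: "F \<in> carrier G"
    and r: "\<And>x y. x \<in> X \<Longrightarrow> y \<in> X \<Longrightarrow> x 0 \<noteq> y 0 \<Longrightarrow> \<exists>i. \<bar>i\<bar> \<le> r \<and> F x i \<noteq> F y i"
    and n: "n \<ge> 1" and k: "k \<in> H n"
  shows "\<exists>i. \<bar>i\<bar> \<le> r \<and> k + rot n F + i \<in> H n"
proof -
  obtain a b where ab: "[a = k] (mod int (p n))" "[b = k] (mod int (p n))" "\<eta> a \<noteq> \<eta> b"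
    using k unfolding mem_holes_iff by blast
  then obtain i where i: "\<bar>i\<bar> \<le> r" "F (\<lambda>k. \<eta> (k + a)) i \<noteq> F (\<lambda>k. \<eta> (k + b)) i"
    using r[OF orbit_in orbit_in, of a b] by auto
  \<comment> \<open>By \<open>approximation\<close>, the value at \<open>i\<close> of a point over
    \<open>k + rot n F\<close> is a value of \<open>\<eta>\<close> in the class of
    \<open>k + rot n F + i\<close>.\<close>
  have approx: "\<exists>m. [m = k + rot n F + i] (mod int (p n)) \<and> F (\<lambda>k. \<eta> (k + c)) i = \<eta> m"
    if c: "[c = k] (mod int (p n))" for c
  proof -
    obtain m where m: "[\<phi> n (F (\<lambda>k. \<eta> (k + c))) = m] (mod int (p n))"
      "F (\<lambda>k. \<eta> (k + c)) i = \<eta> (i + m)"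
      using approximation[OF n G_in[OF F orbit_in], of "{i}" c] by blast
    have "[\<phi> n (F (\<lambda>k. \<eta> (k + c))) = \<phi> n (\<lambda>k. \<eta> (k + c)) + rot n F] (mod int (p n))"
      by (rule \<phi>_G[OF n F orbit_in])
    also have "[\<phi> n (\<lambda>k. \<eta> (k + c)) + rot n F = k + rot n F] (mod int (p n))"
      by (intro cong_add cong_refl cong_trans[OF \<phi>_orbit[OF n] c])
    finally have "[m = k + rot n F] (mod int (p n))"
      using m(1) cong_sym cong_trans by blast
    then have "[i + m = i + (k + rot n F)] (mod int (p n))"
      by (intro cong_add cong_refl)
    then show ?thesis
      using m(2) by (intro exI[of _ "i + m"]) (simp add: add_ac)
  qed
  obtain m where m: "[m = k + rot n F + i] (mod int (p n))" "F (\<lambda>k. \<eta> (k + a)) i = \<eta> m"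
    using approx[OF ab(1)] by blast
  obtain m' where m': "[m' = k + rot n F + i] (mod int (p n))" "F (\<lambda>k. \<eta> (k + b)) i = \<eta> m'"
    using approx[OF ab(2)] by blast
  have "k + rot n F + i \<in> H n"
    unfolding mem_holes_iff using m m' i(2) by metis
  then show ?thesis using i(1) by blast
qed

text \<open>The \<open>i\<close> given by \<open>holes_G\<close> depends on the level. Only finitely
  many \<open>i\<close> are possible, so if each of them failed, one level \<open>n\<close> would
  exclude them all, against \<open>holes_G\<close> for a hole at level \<open>n\<close> in the class
  of \<open>k\<close>.\<close>

lemma essential_holes_G:
  assumes F: "F \<in> carrier G"
    and r: "\<And>x y. x \<in> X \<Longrightarrow> y \<in> X \<Longrightarrow> x 0 \<noteq> y 0 \<Longrightarrow> \<exists>i. \<bar>i\<bar> \<le> r \<and> F x i \<noteq> F y i"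
    and N: "N \<ge> 1" and k: "k \<in> E N"
  shows "\<exists>i. \<bar>i\<bar> \<le> r \<and> k + rot N F + i \<in> E N"
proof (rule ccontr)
  assume neg: "\<not> ?thesis"
  have "\<exists>n\<ge>N. \<forall>j\<in>H n. \<not> [j = k + rot N F + i] (mod int (p N))" if "\<bar>i\<bar> \<le> r" for i
    using neg that mem_essential_holes_iff[of "k + rot N F + i" N] by blast
  then obtain \<nu> where \<nu>: "\<And>i. \<bar>i\<bar> \<le> r \<Longrightarrow> \<nu> i \<ge> N"
    "\<And>i j. \<bar>i\<bar> \<le> r \<Longrightarrow> j \<in> H (\<nu> i) \<Longrightarrow> \<not> [j = k + rot N F + i] (mod int (p N))"
    by metis
  obtain b where b: "\<And>i. i \<in> {- r..r} \<Longrightarrow> \<nu> i \<le> b"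
    by (rule finite_bounded[of "{- r..r}" \<nu>]) auto
  define n where "n = max b N"
  have n: "n \<ge> N" "n \<ge> 1" "\<And>i. \<bar>i\<bar> \<le> r \<Longrightarrow> \<nu> i \<le> n"
    using b N by (auto simp: n_def abs_le_iff le_max_iff_disj)
  obtain j where j: "j \<in> H n" "[j = k] (mod int (p N))"
    using k n(1) unfolding mem_essential_holes_iff by blast
  obtain i where i: "\<bar>i\<bar> \<le> r" "j + rot n F + i \<in> H n"
    using holes_G[OF F r n(2) j(1)] by blast
  have "j + rot n F + i \<in> H (\<nu> i)"
    using holes_mono[OF _ n(3)[OF i(1)]] \<nu>(1)[OF i(1)] N i(2) by auto
  moreover have "[j + rot n F + i = k + rot N F + i] (mod int (p N))"
    by (intro cong_add cong_refl j(2) G.f_cong[OF N n(1) F])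
  ultimately show False
    using \<nu>(2)[OF i(1)] by blast
qed

text \<open>In the second claim one inclusion suffices: \<open>p N\<close> translations by
  \<open>t\<close> lead back to the same residue class.\<close>

lemma min_period_E:
  assumes "N \<ge> 1"
  shows "min_period (E N) \<ge> 1"
    and "(\<And>k. k \<in> E N \<Longrightarrow> k + t \<in> E N) \<Longrightarrow> int (min_period (E N)) dvd t"
    and "min_period (E N) dvd p N"
proof -
  have per: "k + int (p N) \<in> E N \<longleftrightarrow> k \<in> E N" for k
    by (rule essential_holes_cong) (simp add: cong_iff_dvd_diff)
  note min = min_period_pos[OF p_pos[OF assms] per] min_period_dvd[OF p_pos[OF assms] per]
  show "min_period (E N) \<ge> 1"
    by (rule min)
  show "min_period (E N) dvd p N"
    using min(2)[OF per] by simp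
  assume t: "k \<in> E N \<Longrightarrow> k + t \<in> E N" for k
  have "k \<in> E N" if "k + t \<in> E N" for k
  proof -
    have "k + t + int j * t \<in> E N" for j
    proof (induction j)
      case (Suc j)
      then show ?case using t[OF Suc] by (simp add: algebra_simps)
    qed (use that in simp)
    \<comment> \<open>One translation is already contained in \<open>k + t\<close>.\<close>
    from this[of "p N - 1"] have "k + int (p N) * t \<in> E N"
      using p_pos[OF assms] by (simp add: algebra_simps)
    then show ?thesis
      using essential_holes_cong[of "k + int (p N) * t" k N] by (simp add: cong_iff_dvd_diff)
  qed
  then show "int (min_period (E N)) dvd t"
    using t by (intro min(2)) blast
qed

lemma eventually_period:
  assumes inter: "(\<Inter>n\<in>{1..}. generate integer_group (E n)) = {0}"
    and F: "F \<in> carrier G"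
  shows "\<exists>i N. \<forall>n\<ge>N. int (min_period (E n)) dvd rot n F + i"
proof -
  define S where "S = (\<lambda>n. generate integer_group (E n))"
  have sub: "subgroup (S n) integer_group" for n
    unfolding S_def by (rule group.generate_is_subgroup[OF group_integer_group]) simp
  have add: "a + b \<in> S n" if "a \<in> S n" "b \<in> S n" for a b n
    using subgroup.m_closed[OF sub that] by simp
  have uminus: "- a \<in> S n" if "a \<in> S n" for a n
    using subgroup.m_inv_closed[OF sub that] by simp
  have diff: "a - b \<in> S n" if "a \<in> S n" "b \<in> S n" for a b n
    using add[OF that(1) uminus[OF that(2)]] by simp
  have E_S: "k \<in> S n" if "k \<in> E n" for k n
    unfolding S_def using that by (rule generate.incl)
  have mono: "S n' \<subseteq> S n" if "1 \<le> n" "n \<le> n'" for n n'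
    unfolding S_def by (rule group.mono_generate[OF group_integer_group essential_holes_mono[OF that]])
  \<comment> \<open>\<open>E n\<close> is nonempty and invariant under multiples of
    \<open>p n\<close>, so these are differences of its elements.\<close>
  have p_S: "a \<in> S n" if n: "n \<ge> 1" and dvd: "int (p n) dvd a" for a n
  proof -
    obtain k where k: "k \<in> E n"
      using essential_holes_nonempty[OF n] by blast
    then have "k + a \<in> E n"
      using essential_holes_cong[of "k + a" k n] dvd by (simp add: cong_iff_dvd_diff)
    then show ?thesis
      using diff[OF E_S E_S[OF k], of "k + a"] by simp
  qed
  obtain r where r: "\<And>x y. x \<in> X \<Longrightarrow> y \<in> X \<Longrightarrow> x 0 \<noteq> y 0 \<Longrightarrow> \<exists>i. \<bar>i\<bar> \<le> r \<and> F x i \<noteq> F y i"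
    using separation[OF F] by metis
  have shifted: "\<exists>i. \<bar>i\<bar> \<le> r \<and> k + rot n F + i \<in> E n" if "n \<ge> 1" "k \<in> E n" for n k
    by (rule essential_holes_G[OF F _ that]) (rule r)
  have "\<exists>n\<ge>1. t \<notin> S n" if "t \<noteq> 0" for t
  proof -
    have "t \<notin> (\<Inter>n\<in>{1..}. S n)"
      unfolding S_def inter using that by simp
    then show ?thesis by auto
  qed
  then obtain \<nu> where \<nu>: "\<And>t. t \<noteq> 0 \<Longrightarrow> \<nu> t \<ge> 1 \<and> t \<notin> S (\<nu> t)"
    by metis
  \<comment> \<open>Two corrections of size at most \<open>r\<close> differ by at most
    \<open>2 * r\<close>; \<open>N\<close> is chosen so that \<open>S N\<close> contains no nonzero
    number of that size.\<close>
  obtain b where b: "\<And>t. t \<in> {- 2 * r..2 * r} \<Longrightarrow> \<nu> t \<le> b"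
    by (rule finite_bounded[of "{- 2 * r..2 * r}" \<nu>]) auto
  define N where "N = max 1 b"
  then have N: "N \<ge> 1" by simp
  have small: "t = 0" if "\<bar>t\<bar> \<le> 2 * r" "t \<in> S N" for t
  proof (rule ccontr)
    assume t: "t \<noteq> 0"
    have "\<nu> t \<le> N"
      using b[of t] that(1) by (auto simp: N_def abs_le_iff)
    then show False
      using mono[of "\<nu> t" N] \<nu>[OF t] that(2) by blast
  qed
  obtain k where k: "k \<in> E N"
    using essential_holes_nonempty[OF N] by blast
  \<comment> \<open>One essential hole at level \<open>N\<close> fixes the correction for all
    essential holes at all levels from \<open>N\<close> on.\<close>
  obtain i where i: "\<bar>i\<bar> \<le> r" "k + rot N F + i \<in> E N"
    using shifted[OF N k] by blast
  have fi: "rot N F + i \<in> S N"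
    using diff[OF E_S[OF i(2)] E_S[OF k]] by (simp add: algebra_simps)
  have "int (min_period (E n)) dvd rot n F + i" if n: "n \<ge> N" for n
  proof (rule min_period_E(2))
    show n1: "n \<ge> 1"
      using N n by simp
    fix k assume k: "k \<in> E n"
    obtain j where j: "\<bar>j\<bar> \<le> r" "k + rot n F + j \<in> E n"
      using shifted[OF n1 k] by blast
    have "rot n F + j \<in> S n"
      using diff[OF E_S[OF j(2)] E_S[OF k]] by (simp add: algebra_simps)
    then have "rot n F + j \<in> S N"
      using mono[OF N n] by blast
    then have "(rot n F + j) - (rot N F + i) \<in> S N"
      by (rule diff[OF _ fi])
    \<comment> \<open>The rotations at levels \<open>n\<close> and \<open>N\<close> thus cancel
      modulo \<open>S N\<close>, leaving \<open>j - i\<close>.\<close>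
    moreover have "rot n F - rot N F \<in> S N"
      using G.f_cong[OF N n F] by (intro p_S[OF N]) (simp add: cong_iff_dvd_diff)
    ultimately have "((rot n F + j) - (rot N F + i)) - (rot n F - rot N F) \<in> S N"
      by (rule diff)
    then have "j - i \<in> S N"
      by simp
    then have "j = i"
      using small[of "j - i"] i(1) j(1) by auto
    then show "k + (rot n F + i) \<in> E n"
      using j(2) by (simp add: add_ac)
  qed
  then show ?thesis by blast
qed

end

text \<open>Subtracting the coordinates of \<open>\<pi> \<eta>\<close> puts \<open>\<eta>\<close>
  over 0. The differences may be negative, which is harmless as the relations are
  congruences.\<close>

lemma toeplitz_rotation_if_factor_map:
  assumes toeplitz: "nonperiodic_toeplitz \<eta> p"
    and factor: "factor_map (top_of_set (orbit_closure \<eta>)) shift (odometer p) (odometer_translation p) \<pi>"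
  shows "toeplitz_rotation \<eta> p (\<lambda>n x. \<pi> x n - \<pi> \<eta> n)"
proof -
  let ?X = "orbit_closure \<eta>"
  have cont: "continuous_map (top_of_set ?X) (product_topology (\<lambda>n. discrete_topology {0..<int (p n)}) {1..}) \<pi>"
    and Suc: "\<And>n x. n \<ge> 1 \<Longrightarrow> x \<in> ?X \<Longrightarrow> \<pi> x (Suc n) mod int (p n) = \<pi> x n"
    and trans: "\<And>x. x \<in> ?X \<Longrightarrow> \<pi> (shift x) = odometer_translation p (\<pi> x)"
    using factor by (auto simp: factor_map_def odometer_def continuous_map_in_subtopology Pi_iff)
  have coord: "continuous_map (top_of_set ?X) (discrete_topology {0..<int (p n)}) (\<lambda>x. \<pi> x n)" if "n \<ge> 1" for n
    using cont that by (simp add: continuous_map_componentwise)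
  show ?thesis
  proof
    fix n :: nat and c :: int assume n: "n \<ge> 1"
    have "openin (top_of_set ?X) {x \<in> topspace (top_of_set ?X). \<pi> x n \<in> {0..<int (p n)} \<inter> {c + \<pi> \<eta> n}}"
      by (rule openin_continuous_map_preimage[OF coord[OF n]]) simp
    moreover have "\<pi> x n \<in> {0..<int (p n)}" if "x \<in> ?X" for x
      using continuous_map_funspace[OF coord[OF n]] that by (auto simp: Pi_iff)
    ultimately show "openin (top_of_set ?X) {x \<in> ?X. \<pi> x n - \<pi> \<eta> n = c}"
      by (elim back_subst[of "openin (top_of_set ?X)"]) auto
  next
    fix n :: nat and x assume n: "n \<ge> 1" and x: "x \<in> ?X"
    have "\<pi> (shift x) n = (\<pi> x n + 1) mod int (p n)"
      using trans[OF x] n by (simp add: odometer_translation_def)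
    then have "[\<pi> (shift x) n = \<pi> x n + 1] (mod int (p n))"
      by (simp add: cong_def)
    then have "[\<pi> (shift x) n - \<pi> \<eta> n = \<pi> x n + 1 - \<pi> \<eta> n] (mod int (p n))"
      by (intro cong_diff cong_refl)
    then show "[\<pi> (shift x) n - \<pi> \<eta> n = \<pi> x n - \<pi> \<eta> n + 1] (mod int (p n))"
      by (simp add: algebra_simps)
    have "[\<pi> y (Suc n) = \<pi> y n] (mod int (p n))" if "y \<in> ?X" for y
      using Suc[OF n that] by (metis cong_def mod_mod_trivial)
    then show "[\<pi> x (Suc n) - \<pi> \<eta> (Suc n) = \<pi> x n - \<pi> \<eta> n] (mod int (p n))"
      using x mem_orbit_closure[of \<eta>] by (intro cong_diff)
  qed (use toeplitz in auto)
qed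

section \<open>Assembly from the hypotheses on \<open>A n\<close> and on the limit inferior\<close>

theorem corollary2p21:
  fixes \<eta> :: "int \<Rightarrow> bool" and p :: "nat \<Rightarrow> nat" and A :: "nat \<Rightarrow> nat set"
  defines "X \<equiv> top_of_set (orbit_closure \<eta>)"
  defines "G \<equiv> Aut X shift"
  defines "\<sigma> \<equiv> restrict shift (topspace X)"
  defines "Tor \<equiv> torsion G"
  defines "\<tau> \<equiv> (\<lambda>n. min_period (essential_holes \<eta> p n))"
  defines "M \<equiv> liminf (\<lambda>n. ereal (real (p n) / real (\<tau> n)))"
  assumes toeplitz: "nonperiodic_toeplitz \<eta> p"
    and mef: "is_max_equicontinuous_factor X shift (odometer p) (odometer_translation p)"
    and A_pos: "\<And>n. n \<ge> 1 \<Longrightarrow> A n \<subseteq> {1..}"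
    and A_inter: "(\<Inter>n\<in>{1..}. generate integer_group (int ` A n)) = {0}"
    and A_holes: "\<And>n. n \<ge> 1 \<Longrightarrow> essential_holes \<eta> p n \<subseteq> multiples (A n)"
  shows "(M < \<infinity> \<longrightarrow>
            internal_direct_sum G (generate G {\<sigma>}) Tor \<and>
            cyclic_group (G\<lparr>carrier := Tor\<rparr>) \<and>
            finite Tor \<and>
            (\<exists>m::nat. M = ereal (real m) \<and> card Tor dvd m)) \<and>
         (infinite {n. n \<ge> 1 \<and> \<tau> n = p n} \<longrightarrow> carrier G = generate G {\<sigma>})"
proof -
  obtain \<pi> where "factor_map (top_of_set (orbit_closure \<eta>)) shift (odometer p) (odometer_translation p) \<pi>"
    using mef unfolding is_max_equicontinuous_factor_def X_def by blast
  then interpret toeplitz_rotation \<eta> p "\<lambda>n x. \<pi> x n - \<pi> \<eta> n"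
    by (rule toeplitz_rotation_if_factor_map[OF toeplitz])
  have \<sigma>: "\<sigma> = restrict shift (orbit_closure \<eta>)"
    by (simp add: \<sigma>_def X_def)
  \<comment> \<open>\<open>multiples (A n)\<close> lies in the group generated by
    \<open>A n\<close>, so the condition on the intersection passes to the groups generated by the
    essential holes.\<close>
  have gen: "generate integer_group (essential_holes \<eta> p n) \<subseteq> generate integer_group (int ` A n)"
    if n: "n \<ge> 1" for n
  proof (rule group.generate_subgroup_incl[OF group_integer_group])
    show sub: "subgroup (generate integer_group (int ` A n)) integer_group"
      by (rule group.generate_is_subgroup[OF group_integer_group]) simp
    have "j * int a \<in> generate integer_group (int ` A n)" if "a \<in> A n" for a j
      using group.subgroup_int_pow_closed[OF group_integer_group sub generate.incl[of "int a"], of j] that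
      by simp
    then have "multiples (A n) \<subseteq> generate integer_group (int ` A n)"
      by (auto simp: multiples_def mult.commute)
    then show "essential_holes \<eta> p n \<subseteq> generate integer_group (int ` A n)"
      using A_holes[OF n] by blast
  qed
  have inter: "(\<Inter>n\<in>{1..}. generate integer_group (essential_holes \<eta> p n)) = {0}"
  proof
    have "(\<Inter>n\<in>{1..}. generate integer_group (essential_holes \<eta> p n))
        \<subseteq> (\<Inter>n\<in>{1..}. generate integer_group (int ` A n))"
      by (rule INT_anti_mono) (use gen in auto)
    then show "(\<Inter>n\<in>{1..}. generate integer_group (essential_holes \<eta> p n)) \<subseteq> {0}"
      by (simp only: A_inter)
    have "0 \<in> generate integer_group S" for S
      using generate.one[of integer_group S] by simp
    then show "{0} \<subseteq> (\<Inter>n\<in>{1..}. generate integer_group (essential_holes \<eta> p n))"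
      by simp
  qed
  have ex: "\<exists>i N. \<forall>n\<ge>N. int (\<tau> n) dvd rot n F + i" if "F \<in> carrier G" for F
    using eventually_period[OF inter] that unfolding \<tau>_def G_def X_def by blast
  have \<tau>: "\<tau> n \<ge> 1" "\<tau> n dvd p n" if "n \<ge> 1" for n
    using min_period_E[OF that] by (simp_all add: \<tau>_def)
  have pos: "m \<ge> 1" if inf: "infinite {n. n \<ge> 1 \<and> p n = m * \<tau> n}" for m
  proof -
    obtain n where "n \<ge> 1" "p n = m * \<tau> n"
      using not_finite_existsD[OF inf] by blast
    then show ?thesis
      using p_pos[of n] by (cases m) auto
  qed
  note facts = ex[unfolded G_def X_def]
  \<comment> \<open>Stated for every \<open>m\<close>: the direct sum uses the value of the limit
    inferior, the last claim uses \<open>m = 1\<close>.\<close>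
  have fin: "internal_direct_sum G (generate G {\<sigma>}) Tor \<and> cyclic_group (G\<lparr>carrier := Tor\<rparr>) \<and>
      finite Tor \<and> card Tor dvd m \<and> (m = 1 \<longrightarrow> carrier G = generate G {\<sigma>})"
    if inf: "infinite {n. n \<ge> 1 \<and> p n = m * \<tau> n}" for m
    unfolding Tor_def \<sigma> unfolding G_def X_def
    using G.direct_sum_torsion[OF pos[OF inf] inf p_pos facts]
      G.cyclic_torsion[OF pos[OF inf] inf p_pos facts]
      G.finite_torsion[OF pos[OF inf] inf p_pos facts]
      G.card_torsion[OF pos[OF inf] inf p_pos facts]
      G.carrier_eq_generate[OF pos[OF inf] inf p_pos facts]
    by blast
  show ?thesis
  proof (intro conjI impI)
    assume "infinite {n. n \<ge> 1 \<and> \<tau> n = p n}"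
    then show "carrier G = generate G {\<sigma>}"
      using fin[of 1] by (simp add: eq_commute)
  next
    assume fin_M: "M < \<infinity>"
    \<comment> \<open>From index 1 on, \<open>\<tau> n\<close> divides \<open>p n\<close>, so the
      limit inferior is that of a sequence of naturals and is attained infinitely often if
      finite.\<close>
    have "eventually (\<lambda>n. ereal (real (p n) / real (\<tau> n)) = ereal (real (p n div \<tau> n))) sequentially"
      using eventually_ge_at_top[of 1] by (rule eventually_mono) (simp add: real_of_nat_div \<tau>)
    then have M: "M = liminf (\<lambda>n. ereal (real (p n div \<tau> n)))"
      unfolding M_def by (rule Liminf_eq)
    obtain m where m: "M = ereal (real m)" "infinite {n. p n div \<tau> n = m}"
      using liminf_nat_attained[of "\<lambda>n. p n div \<tau> n"] fin_M unfolding M by metis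
    have "{n. p n div \<tau> n = m} - {0} \<subseteq> {n. n \<ge> 1 \<and> p n = m * \<tau> n}"
      using \<tau>(2) by (auto simp: Suc_le_eq)
    then have "infinite {n. n \<ge> 1 \<and> p n = m * \<tau> n}"
      using m(2) finite_subset by (metis finite_Diff2 finite.emptyI finite.insertI)
    then show "internal_direct_sum G (generate G {\<sigma>}) Tor" "cyclic_group (G\<lparr>carrier := Tor\<rparr>)"
      "finite Tor" "\<exists>m::nat. M = ereal (real m) \<and> card Tor dvd m"
      using fin[of m] m(1) by auto
  qed
qed

end
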